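(* Let $g \in \mathbb{Z}[x]$ be irreducible in $\mathbb{Z}[x]$ with degree $d \geq 1$ and leading coefficient $c$, let $\alpha \in \mathbb{C}$ be a root of $g$, and let $\mathbb{K} = \mathbb{Q}(\alpha)$. Let $D_g$ be the discriminant of $g$ and define $\mathbf{D}_g = |c|^{(d-1)(d-2)} |D_g|$. Then for every real $x > \max\{2,\sqrt{\mathbf{D}_g}\}$, $$\sum_{p\leq x} \frac{\omega_g(p)}{p} = \sum_{N(\mathfrak{p})\leq x} \frac{1}{N(\mathfrak{p})} + A_g,$$ where $A_g$ is a real number (possibly depending on $x$) with $$|A_g| \leq d\left( \mathbf{M}_{\mathbb{Q}}(|c|) + \mathbf{M}_{\mathbb{Q}}\big(\sqrt{\mathbf{D}_g}\big) + 0.64\right).$$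
   Context: The letter $p$ denotes a rational prime. $\omega_g(p)$ is the number of solutions $x \in \mathbb{Z}/p\mathbb{Z}$ of $g(x) \equiv 0 \pmod p$. The sum over $N(\mathfrak{p}) \leq x$ runs over the nonzero prime ideals $\mathfrak{p}$ of the ring of integers $\mathcal{O}_{\mathbb{K}}$ with norm $N(\mathfrak{p}) = |\mathcal{O}_{\mathbb{K}}/\mathfrak{p}| \leq x$. For real $y$, $\mathbf{M}_{\mathbb{Q}}(y) = \sum_{p \leq y} 1/p$ (so $\mathbf{M}_{\mathbb{Q}}(y) = 0$ for $y<2$). A nonconstant polynomial is irreducible in $\mathbb{Z}[x]$ if and only if it is primitive (its coefficients have greatest common divisor $1$) and irreducible in $\mathbb{Q}[x]$. The discriminant of a polynomial of degree $n$ with leading coefficient $a_n$ and complex roots $\lambda_1,\ldots,\lambda_n$ (with multiplicity) is $a_n^{2n-2}\prod_{1\le i<j\le n}(\lambda_i-\lambda_j)^2$; it equals $1$ if $n=1$. *)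

theory Defs
  imports
    "HOL-Analysis.Analysis"
    "HOL-Computational_Algebra.Computational_Algebra"
    "HOL-Number_Theory.Number_Theory"
    "HOL-Algebra.Generated_Fields"
    "HOL-Algebra.Algebraic_Closure_Type"
begin

definition omega :: "int poly \<Rightarrow> nat \<Rightarrow> nat" where
  "omega g p = card {a \<in> {0..<int p}. [poly g a = 0] (mod int p)}"

definition recip_prime_sum :: "real \<Rightarrow> real" where
  "recip_prime_sum y = (\<Sum>p | Factorial_Ring.prime (p :: nat) \<and> real p \<le> y. 1 / real p)"

definition sq_diff_prod :: "complex list \<Rightarrow> complex" where
  "sq_diff_prod rs = (\<Prod>j<length rs. \<Prod>i<j. (rs ! i - rs ! j)\<^sup>2)"

text \<open>
  The roots are listed with multiplicity, in an arbitrary order; the value does not depend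
  on that order (\<open>discriminant_eq\<close> below). The truncated exponent is only off for constants.
\<close>
definition discriminant :: "complex poly \<Rightarrow> complex" where
  "discriminant f =
     Polynomial.lead_coeff f ^ (2 * Polynomial.degree f - 2) * sq_diff_prod (SOME rs. mset rs = proots f)"

lemma sq_diff_prod_Cons:
  "sq_diff_prod (x # rs) = prod_list (map (\<lambda>r. (x - r)\<^sup>2) rs) * sq_diff_prod rs"
proof -
  have "sq_diff_prod (x # rs) =
      (\<Prod>j<length rs. \<Prod>i<Suc j. ((x # rs) ! i - rs ! j)\<^sup>2)"
    unfolding sq_diff_prod_def by (simp only: list.size add_Suc_right add_0_right
        prod.lessThan_Suc_shift nth_Cons_Suc lessThan_0 prod.empty mult_1_left)
  also have "\<dots> = (\<Prod>j<length rs. (x - rs ! j)\<^sup>2 * (\<Prod>i<j. (rs ! i - rs ! j)\<^sup>2))"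
    by (simp only: prod.lessThan_Suc_shift nth_Cons_Suc nth_Cons_0)
  also have "\<dots> = (\<Prod>j<length rs. (x - rs ! j)\<^sup>2) * sq_diff_prod rs"
    by (simp only: prod.distrib sq_diff_prod_def)
  finally show ?thesis
    by (simp add: prod.list_conv_set_nth atLeast0LessThan)
qed

lemma sq_diff_prod_move: "sq_diff_prod (us @ x # vs) = sq_diff_prod (x # us @ vs)"
proof (induction us)
  case (Cons u us)
  show ?case
    using Cons.IH by (simp only: append_Cons sq_diff_prod_Cons list.map prod_list.Cons map_append prod_list.append mult.assoc mult.left_commute mult.commute power2_commute[of u x])
qed simp

lemma sq_diff_prod_cong: "mset xs = mset ys \<Longrightarrow> sq_diff_prod xs = sq_diff_prod ys"
proof (induction xs arbitrary: ys)
  case (Cons x xs)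
  have "x \<in> set ys"
    using Cons.prems by (metis list.set_intros(1) mset_eq_setD)
  then obtain us vs where ys: "ys = us @ x # vs"
    by (meson split_list)
  with Cons.prems have eq: "mset xs = mset (us @ vs)"
    by simp
  have "prod_list (map (\<lambda>r. (x - r)\<^sup>2) xs) = prod_list (map (\<lambda>r. (x - r)\<^sup>2) (us @ vs))"
    using eq by (simp only: mset_map flip: prod_mset_prod_list)
  with Cons.IH[OF eq] show ?case
    by (simp only: ys sq_diff_prod_move sq_diff_prod_Cons)
qed simp

lemma discriminant_eq:
  assumes "mset rs = proots f"
  shows "discriminant f = Polynomial.lead_coeff f ^ (2 * Polynomial.degree f - 2) * sq_diff_prod rs"
proof -
  have "mset (SOME rs. mset rs = proots f) = mset rs"
    using someI[of "\<lambda>rs. mset rs = proots f", OF assms] assms by simp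
  from sq_diff_prod_cong[OF this] show ?thesis
    by (simp only: discriminant_def)
qed

definition rat_adjoin :: "complex \<Rightarrow> complex set" where
  "rat_adjoin \<alpha> = generate_field ring_of_type_algebra (insert \<alpha> \<rat>)"

definition ring_of_integers :: "complex set \<Rightarrow> complex ring" where
  "ring_of_integers K = ring_of_type_algebra\<lparr>carrier := {z \<in> K. algebraic_int z}\<rparr>"

definition ideal_norm :: "('a, 'b) ring_scheme \<Rightarrow> 'a set \<Rightarrow> nat" where
  "ideal_norm R I = card (carrier (R Quot I))"

end

theory Submission
  imports Defs "Jordan_Normal_Form.Char_Poly" "Berlekamp_Zassenhaus.Factor_Bound"
begin

text \<open>
Put \<open>\<beta> = c \<alpha>\<close>, an algebraic integer with the monic minimal polynomial
\<open>h\<close> given by \<open>h (c X) = c ^ (d - 1) g X\<close>. Scaling the roots by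
\<open>c\<close> shows that the discriminant of \<open>h\<close> has absolute value
\<open>D\<close>. Let \<open>R\<close> be the ring of integers of \<open>K = \<rat>(\<alpha>) =
\<rat>(\<beta>)\<close>. Every nonzero prime ideal of \<open>R\<close> contains exactly one
rational prime \<open>p\<close>, and its norm is either \<open>p\<close> or at least
\<open>p\<^sup>2\<close>. The two sums are compared one \<open>p\<close> at a time.

For \<open>p\<close> with \<open>p > \<bar>c\<bar>\<close> and \<open>p > sqrt D\<close> the
number of primes of norm exactly \<open>p\<close> equals \<open>omega g p\<close>. Such primes
are kernels of ring homomorphisms from \<open>R\<close> to the field with \<open>p\<close>
elements, and these restrict to homomorphisms on \<open>\<int>[\<beta>]\<close>, that is to
roots of \<open>h\<close> modulo \<open>p\<close> (\<open>card_degree_one_primes\<close>); since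
\<open>p\<close> does not divide \<open>c\<close>, those correspond to roots of \<open>g\<close>
(\<open>omega_monic_scale\<close>). The restriction is bijective because every element of
\<open>R\<close> has a multiple by an integer prime to \<open>p\<close> in
\<open>\<int>[\<beta>]\<close> (\<open>coprime_denominator\<close>). If this failed, some
\<open>z \<in> R\<close> would have the form \<open>r \<beta>\<close> with \<open>r\<close>
rational of degree \<open>k < d\<close> and leading coefficient \<open>1 / p\<close>. Lagrange
interpolation at the conjugates of \<open>\<beta>\<close>, with denominators cleared by a
product of differences of roots, would then show that the discriminant of \<open>h\<close>
divided by \<open>p\<^sup>2\<close> is an algebraic integer
(\<open>algebraic_int_coeff_sq_diff_prod\<close>). The discriminant is rational and nonzero
(\<open>sq_diff_prod_proots_rational\<close>), so the quotient would be a nonzero integer and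
\<open>D \<ge> p\<^sup>2\<close>.

For the remaining \<open>p\<close> it is enough that both \<open>omega g p\<close> and the
number of primes above \<open>p\<close> are at most \<open>d\<close>. The second bound
(\<open>card_primes_above\<close>) and the finiteness of the residue rings
(\<open>finite_quotient\<close>) come from the same remark: any \<open>d + 1\<close> elements of
\<open>K\<close> satisfy an integer relation whose coefficients are not all divisible by
\<open>p\<close> (\<open>integer_relation\<close>), and such a relation stays nontrivial modulo
a prime above \<open>p\<close>.

Thus the primes \<open>p \<le> \<bar>c\<bar>\<close> and \<open>p \<le> sqrt D\<close>
contribute at most \<open>d / p\<close> each to the difference, and the prime ideals whose norm
is not a rational prime contribute at most \<open>d / p\<^sup>2\<close> for each
\<open>p\<close>. As \<open>\<Sum> 1 / p\<^sup>2 \<le> 1 / 4 + 1 / 4\<close>, where the first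
term is \<open>p = 2\<close> and the second bounds the sum over all odd numbers from
\<open>3\<close> on, the latter total is at most \<open>d / 2 < 0.64 d\<close>.
\<close>

section \<open>Sums and products of algebraic integers\<close>

definition int_span :: "'i set \<Rightarrow> ('i \<Rightarrow> complex) \<Rightarrow> complex set" where
  "int_span I v = {w. \<exists>a. w = (\<Sum>i\<in>I. of_int (a i) * v i)}"

lemma int_span_add:
  assumes "w \<in> int_span I v" "w' \<in> int_span I v"
  shows "w + w' \<in> int_span I v"
proof -
  obtain a b where "w = (\<Sum>i\<in>I. of_int (a i) * v i)" "w' = (\<Sum>i\<in>I. of_int (b i) * v i)"
    using assms by (auto simp: int_span_def)
  then have "w + w' = (\<Sum>i\<in>I. of_int (a i + b i) * v i)"
    by (simp add: sum.distrib distrib_right)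
  then show ?thesis unfolding int_span_def by (intro CollectI exI)
qed

lemma int_span_scale:
  assumes "w \<in> int_span I v"
  shows "of_int k * w \<in> int_span I v"
proof -
  obtain a where "w = (\<Sum>i\<in>I. of_int (a i) * v i)"
    using assms by (auto simp: int_span_def)
  then have "of_int k * w = (\<Sum>i\<in>I. of_int (k * a i) * v i)"
    by (simp add: sum_distrib_left mult.assoc)
  then show ?thesis unfolding int_span_def by (intro CollectI exI)
qed

lemma int_span_zero: "0 \<in> int_span I v"
  unfolding int_span_def by (auto intro!: exI[of _ "\<lambda>_. 0"])

lemma int_span_sum: "(\<And>j. j \<in> J \<Longrightarrow> f j \<in> int_span I v) \<Longrightarrow> sum f J \<in> int_span I v"
  by (induction J rule: infinite_finite_induct) (auto simp: int_span_zero int_span_add)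

lemma int_span_gen: "finite I \<Longrightarrow> i \<in> I \<Longrightarrow> v i \<in> int_span I v"
  unfolding int_span_def
  by (auto intro!: exI[of _ "\<lambda>j. if j = i then 1 else 0"] simp: if_distrib[of of_int] if_distrib[of "\<lambda>x. x * _"] cong: if_cong)

lemma int_span_mult:
  assumes "\<And>i. i \<in> I \<Longrightarrow> x * v i \<in> int_span I v" "w \<in> int_span I v"
  shows "x * w \<in> int_span I v"
proof -
  obtain a where w: "w = (\<Sum>i\<in>I. of_int (a i) * v i)"
    using assms(2) by (auto simp: int_span_def)
  have "x * w = (\<Sum>i\<in>I. of_int (a i) * (x * v i))"
    by (simp add: w sum_distrib_left mult_ac)
  then show ?thesis
    by (auto intro!: int_span_sum int_span_scale assms)
qed

text \<open>
The integer matrix of multiplication by \<open>z\<close> on the generators \<open>v\<close> has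
the nonzero vector of values of \<open>v\<close> as an eigenvector with eigenvalue
\<open>z\<close>, so \<open>z\<close> is a root of its characteristic polynomial, which is monic
with integer coefficients.
\<close>
lemma algebraic_int_if_int_span_stable:
  fixes v :: "'i \<Rightarrow> complex"
  assumes I: "finite I" and nz: "i\<^sub>0 \<in> I" "v i\<^sub>0 \<noteq> 0"
    and stable: "\<And>i. i \<in> I \<Longrightarrow> z * v i \<in> int_span I v"
  shows "algebraic_int z"
proof -
  have "\<forall>i\<in>I. \<exists>a. z * v i = (\<Sum>j\<in>I. of_int (a j) * v j)"
    using stable by (auto simp: int_span_def)
  then obtain A where A: "\<And>i. i \<in> I \<Longrightarrow> z * v i = (\<Sum>j\<in>I. of_int (A i j) * v j)"
    by metis
  define n where "n = card I"
  obtain f where f: "bij_betw f {0..<n} I"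
    using ex_bij_betw_nat_finite[OF I] unfolding n_def by blast
  define M :: "int mat" where "M = mat n n (\<lambda>(i, j). A (f i) (f j))"
  define M' :: "complex mat" where "M' = map_mat of_int M"
  define w where "w = vec n (v \<circ> f)"
  have M: "M \<in> carrier_mat n n" and M': "M' \<in> carrier_mat n n"
    by (auto simp: M_def M'_def)
  have "M' *\<^sub>v w = z \<cdot>\<^sub>v w"
  proof (rule eq_vecI)
    fix i assume i: "i < dim_vec (z \<cdot>\<^sub>v w)"
    then have i': "i < n" by (simp add: w_def)
    have fi: "f i \<in> I" using i' f by (auto simp: bij_betw_def)
    have "(M' *\<^sub>v w) $ i = (\<Sum>j\<in>{0..<n}. of_int (A (f i) (f j)) * v (f j))"
      using i' by (simp add: M'_def M_def w_def scalar_prod_def)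
    also have "\<dots> = (\<Sum>j\<in>I. of_int (A (f i) j) * v j)"
      by (rule sum.reindex_bij_betw[OF f])
    also have "\<dots> = (z \<cdot>\<^sub>v w) $ i"
      using i' by (simp add: w_def A[OF fi])
    finally show "(M' *\<^sub>v w) $ i = (z \<cdot>\<^sub>v w) $ i" .
  qed (use M' in \<open>auto simp: w_def\<close>)
  moreover have "w \<noteq> 0\<^sub>v n"
  proof
    assume w0: "w = 0\<^sub>v n"
    obtain k where k: "k < n" "f k = i\<^sub>0"
      using f nz(1) by (metis atLeastLessThan_iff bij_betw_imp_surj_on imageE)
    have "w $ k = 0" using w0 k by simp
    then show False using k nz by (simp add: w_def)
  qed
  ultimately have "eigenvector M' w z"
    using M' by (auto simp: eigenvector_def w_def)
  then have "poly (char_poly M') z = 0"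
    using eigenvalue_root_char_poly[OF M'] by (auto simp: eigenvalue_def)
  then have "poly (map_poly of_int (char_poly M)) z = 0"
    unfolding M'_def of_int_hom.char_poly_hom[OF M] .
  moreover have "Polynomial.lead_coeff (char_poly M) = 1"
    using degree_monic_char_poly[OF M] by simp
  ultimately show ?thesis
    unfolding algebraic_int_altdef_ipoly by blast
qed

lemma algebraic_int_power_reduction:
  fixes x :: complex
  assumes "algebraic_int x"
  obtains m a where "m > 0" "x ^ m = (\<Sum>i<m. of_int (a i) * x ^ i)"
proof -
  obtain p :: "int poly" where p: "poly (map_poly of_int p) x = 0" "Polynomial.lead_coeff p = 1"
    using assms unfolding algebraic_int_altdef_ipoly by blast
  define m where "m = Polynomial.degree p"
  have "0 = (\<Sum>i\<le>m. of_int (Polynomial.coeff p i) * x ^ i)"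
    using p(1) by (simp add: poly_altdef m_def)
  also have "\<dots> = (\<Sum>i<m. of_int (Polynomial.coeff p i) * x ^ i) + x ^ m"
    using p(2) by (simp add: m_def flip: lessThan_Suc_atMost)
  finally have "x ^ m = (\<Sum>i<m. of_int (- Polynomial.coeff p i) * x ^ i)"
    by (simp add: sum_negf eq_neg_iff_add_eq_0 add.commute)
  moreover have "m > 0"
    using calculation by (intro Nat.gr0I) auto
  ultimately show ?thesis by (rule that[rotated])
qed

text \<open>
If \<open>x\<close> and \<open>y\<close> are roots of monic integer polynomials of degrees
\<open>m\<close> and \<open>n\<close>, then the module spanned by the products \<open>x ^ i * y
^ j\<close> with \<open>i < m\<close> and \<open>j < n\<close> is stable under multiplication by
\<open>x\<close> and by \<open>y\<close>.
\<close>
lemma algebraic_int_add_mult: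
  fixes x y :: complex
  assumes x: "algebraic_int x" and y: "algebraic_int y"
  shows "algebraic_int (x + y)" and "algebraic_int (x * y)"
proof -
  obtain m a where m: "m > 0" "x ^ m = (\<Sum>i<m. of_int (a i) * x ^ i)"
    by (rule algebraic_int_power_reduction[OF x])
  obtain n b where n: "n > 0" "y ^ n = (\<Sum>i<n. of_int (b i) * y ^ i)"
    by (rule algebraic_int_power_reduction[OF y])
  define I where "I = {..<m} \<times> {..<n}"
  define v where "v = (\<lambda>(i, j). x ^ i * y ^ j)"
  have I: "finite I" "(0, 0) \<in> I" "v (0, 0) \<noteq> 0"
    using m n by (auto simp: I_def v_def)
  have xv: "x * v t \<in> int_span I v" if t: "t \<in> I" for t
  proof -
    obtain i j where ij: "t = (i, j)" "i < m" "j < n" using t by (auto simp: I_def)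
    show ?thesis
    proof (cases "Suc i < m")
      case True
      then have "v (Suc i, j) \<in> int_span I v"
        using ij by (intro int_span_gen I) (auto simp: I_def)
      then show ?thesis by (simp add: ij v_def mult_ac)
    next
      case False
      then have "Suc i = m" using ij by simp
      then have "x * v t = x ^ m * y ^ j" by (auto simp: ij v_def)
      also have "\<dots> = (\<Sum>k<m. of_int (a k) * v (k, j))"
        by (simp add: m(2) v_def sum_distrib_right mult.assoc)
      also have "\<dots> \<in> int_span I v"
        using ij by (intro int_span_sum int_span_scale int_span_gen I) (auto simp: I_def)
      finally show ?thesis .
    qed
  qed
  have yv: "y * v t \<in> int_span I v" if t: "t \<in> I" for t
  proof -
    obtain i j where ij: "t = (i, j)" "i < m" "j < n" using t by (auto simp: I_def)
    show ?thesis
    proof (cases "Suc j < n")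
      case True
      then have "v (i, Suc j) \<in> int_span I v"
        using ij by (intro int_span_gen I) (auto simp: I_def)
      then show ?thesis by (simp add: ij v_def mult_ac)
    next
      case False
      then have "Suc j = n" using ij by simp
      then have "y * v t = x ^ i * y ^ n" by (auto simp: ij v_def)
      also have "\<dots> = (\<Sum>k<n. of_int (b k) * v (i, k))"
        by (simp add: n(2) v_def sum_distrib_left mult_ac)
      also have "\<dots> \<in> int_span I v"
        using ij by (intro int_span_sum int_span_scale int_span_gen I) (auto simp: I_def)
      finally show ?thesis .
    qed
  qed
  show "algebraic_int (x + y)"
    by (rule algebraic_int_if_int_span_stable[where v = v, OF I]) (simp add: distrib_right int_span_add xv yv)
  show "algebraic_int (x * y)"
    by (rule algebraic_int_if_int_span_stable[where v = v, OF I])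
       (simp add: mult.assoc int_span_mult[OF xv] yv)
qed

lemma algebraic_int_diff:
  "algebraic_int (x :: complex) \<Longrightarrow> algebraic_int y \<Longrightarrow> algebraic_int (x - y)"
  using algebraic_int_add_mult(1)[of x "- y"] by (simp add: algebraic_int_minus)

lemma algebraic_int_power: "algebraic_int (x :: complex) \<Longrightarrow> algebraic_int (x ^ n)"
  by (induction n) (auto intro: algebraic_int_add_mult)

lemma algebraic_int_prod_list:
  "(\<And>x. x \<in> set xs \<Longrightarrow> algebraic_int (x :: complex)) \<Longrightarrow> algebraic_int (prod_list xs)"
  by (induction xs) (auto intro: algebraic_int_add_mult)

section \<open>Integral interpolation\<close>

text \<open>
This is Lagrange interpolation without denominators. For \<open>k + 1\<close> points, the
coefficient of \<open>r\<close> at \<open>k\<close> is the divided difference \<open>\<Sum> r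
x\<^sub>i / \<Prod> (x\<^sub>i - x\<^sub>j)\<close>, and multiplying it by the product of all
differences of the points makes it integral in the points and in the values of \<open>r\<close>.
The induction removes one point \<open>x\<close> and passes to \<open>q = (r - r x) / (X -
x)\<close>. This may have non-integral values, so it is scaled by the product \<open>W\<close>
of the differences \<open>y - x\<close>, whose square is exactly what
\<open>sq_diff_prod\<close> gains from \<open>x\<close>.
\<close>
lemma algebraic_int_coeff_sq_diff_prod:
  fixes r :: "complex poly"
  assumes "Polynomial.degree r \<le> k" "k < length xs"
    and "\<And>x. x \<in> set xs \<Longrightarrow> algebraic_int x"
    and "\<And>x. x \<in> set xs \<Longrightarrow> algebraic_int (poly r x)"
  shows "algebraic_int ((Polynomial.coeff r k)\<^sup>2 * sq_diff_prod xs)"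
  using assms
proof (induction xs arbitrary: r k)
  case (Cons x xs)
  let ?W = "prod_list (map (\<lambda>y. y - x) xs)"
  have W: "prod_list (map (\<lambda>y. (x - y)\<^sup>2) xs) = ?W\<^sup>2"
    by (induction xs) (simp_all add: power_mult_distrib power2_commute)
  have intW: "algebraic_int ?W"
    using Cons.prems(3) by (intro algebraic_int_prod_list) (auto simp: algebraic_int_diff)
  show ?case
  proof (cases "k < length xs")
    case True
    then have "algebraic_int ((Polynomial.coeff r k)\<^sup>2 * sq_diff_prod xs)"
      using Cons by auto
    then have "algebraic_int (?W\<^sup>2 * ((Polynomial.coeff r k)\<^sup>2 * sq_diff_prod xs))"
      by (rule algebraic_int_add_mult(2)[OF algebraic_int_power[OF intW]])
    then show ?thesis unfolding sq_diff_prod_Cons W by (simp add: mult_ac)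
  next
    case False
    then have k: "k = length xs" using Cons.prems by simp
    show ?thesis
    proof (cases k)
      case 0
      then have "Polynomial.degree r = 0" "xs = []" using Cons.prems k by auto
      then have "Polynomial.coeff r 0 = poly r x" by (simp add: poly_altdef)
      then show ?thesis
        using Cons.prems 0 \<open>xs = []\<close> by (auto simp: sq_diff_prod_def intro: algebraic_int_power)
    next
      case (Suc j)
      define q where "q = synthetic_div r x"
      have rq: "r = [:poly r x:] + [:-x, 1:] * q"
        using synthetic_div_correct'[of x r] by (simp add: q_def add.commute)
      have poly_rq: "poly r y - poly r x = (y - x) * poly q y" for y
        using arg_cong[OF rq, of "\<lambda>s. poly s y"] by (simp add: algebra_simps)
      have deg: "Polynomial.degree q \<le> j"
        using Cons.prems(1) Suc by (simp add: q_def degree_synthetic_div)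
      have "Polynomial.coeff q (Suc j) = 0"
        using deg by (intro Polynomial.coeff_eq_0) auto
      then have coeff: "Polynomial.coeff r k = Polynomial.coeff q j"
        using arg_cong[OF rq, of "\<lambda>s. Polynomial.coeff s k"] Suc by simp
      have "algebraic_int ((Polynomial.coeff (Polynomial.smult ?W q) j)\<^sup>2 * sq_diff_prod xs)"
      proof (rule Cons.IH)
        fix y assume y: "y \<in> set xs"
        then obtain us vs where uv: "xs = us @ y # vs" by (meson split_list)
        have "poly (Polynomial.smult ?W q) y
            = prod_list (map (\<lambda>y. y - x) (us @ vs)) * (poly r y - poly r x)"
          by (simp add: poly_rq uv)
        also have "algebraic_int \<dots>"
        proof (rule algebraic_int_add_mult(2))
          have "algebraic_int (u - x)" if "u \<in> set (us @ vs)" for u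
            using that uv by (intro algebraic_int_diff Cons.prems(3)) auto
          then show "algebraic_int (prod_list (map (\<lambda>y. y - x) (us @ vs)))"
            by (intro algebraic_int_prod_list) auto
          show "algebraic_int (poly r y - poly r x)"
            using y by (intro algebraic_int_diff Cons.prems(4)) auto
        qed
        finally show "algebraic_int (poly (Polynomial.smult ?W q) y)" .
      qed (use Cons.prems k Suc deg in auto)
      then show ?thesis unfolding sq_diff_prod_Cons W coeff
        by (simp add: power_mult_distrib mult_ac)
    qed
  qed
qed simp

section \<open>Rationality of resultants and discriminants\<close>

abbreviation cpoly :: "rat poly \<Rightarrow> complex poly" where
  "cpoly \<equiv> map_poly of_rat"

interpretation cpoly_hom: map_poly_inj_comm_ring_hom "of_rat :: rat \<Rightarrow> complex" ..

lemma prod_mset_diff_swap: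
  fixes A B :: "'a :: comm_ring_1 multiset"
  shows "(\<Prod>a\<in>#A. \<Prod>b\<in>#B. a - b) = (-1) ^ (size A * size B) * (\<Prod>b\<in>#B. \<Prod>a\<in>#A. b - a)"
proof -
  have "(\<Prod>b\<in>#B. a - b) = (-1) ^ size B * (\<Prod>b\<in>#B. b - a)" for a
    by (induction B) (simp_all add: algebra_simps)
  then have "(\<Prod>a\<in>#A. \<Prod>b\<in>#B. a - b) = (-1) ^ (size A * size B) * (\<Prod>a\<in>#A. \<Prod>b\<in>#B. b - a)"
    by (simp add: prod_mset.distrib power_mult mult.commute[of "size A"])
  also have "(\<Prod>a\<in>#A. \<Prod>b\<in>#B. b - a) = (\<Prod>b\<in>#B. \<Prod>a\<in>#A. b - a)"
    by (induction A) (simp_all add: prod_mset.distrib)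
  finally show ?thesis .
qed

lemma poly_eq_prod_proots:
  "poly p z = Polynomial.lead_coeff p * (\<Prod>b\<in>#proots p. z - b)" for p :: "complex poly"
  by (subst complex_poly_decompose_multiset[symmetric, of p])
     (simp add: poly_prod_mset image_mset.compositionality o_def)

text \<open>
Both sides are, up to normalisation, the resultant of \<open>p\<close> and \<open>q\<close>.
\<close>
lemma prod_proots_reciprocity:
  fixes p q :: "complex poly"
  shows "Polynomial.lead_coeff p ^ Polynomial.degree q * (\<Prod>b\<in>#proots p. poly q b) =
    (-1) ^ (Polynomial.degree p * Polynomial.degree q) *
    Polynomial.lead_coeff q ^ Polynomial.degree p * (\<Prod>c\<in>#proots q. poly p c)"
  using minus_one_mult_self[of "Polynomial.degree p * Polynomial.degree q", where 'a = complex]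
  by (simp add: poly_eq_prod_proots[of p] poly_eq_prod_proots[of q] prod_mset.distrib
        size_proots_complex prod_mset_diff_swap[of "proots p" "proots q"]
        mult.commute[of "Polynomial.degree q"])

text \<open>
The resultant of two rational polynomials is rational by the Euclidean algorithm:
\<open>q\<close> may be replaced by its remainder modulo \<open>f\<close>, and reciprocity then
exchanges the roles of the two polynomials.
\<close>
lemma prod_proots_rational:
  fixes f q :: "rat poly"
  assumes "f \<noteq> 0"
  shows "(\<Prod>b\<in>#proots (cpoly f). poly (cpoly q) b) \<in> \<rat>"
  using assms
proof (induction "Polynomial.degree f" arbitrary: f q rule: less_induct)
  case less
  define r where "r = q mod f"
  have "poly (cpoly q) b = poly (cpoly r) b" if "b \<in># proots (cpoly f)" for b
  proof -
    have "poly (cpoly f) b = 0" using that less.prems by simp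
    moreover have "cpoly q = cpoly (q div f) * cpoly f + cpoly r"
      by (simp add: r_def flip: cpoly_hom.hom_mult cpoly_hom.hom_add)
    ultimately show ?thesis by simp
  qed
  then have eq: "(\<Prod>b\<in>#proots (cpoly f). poly (cpoly q) b) = (\<Prod>b\<in>#proots (cpoly f). poly (cpoly r) b)"
    by (intro arg_cong[of _ _ prod_mset] image_mset_cong) auto
  show ?case
  proof (cases "r = 0")
    case True
    then show ?thesis unfolding eq by (cases "proots (cpoly f)") auto
  next
    case False
    show ?thesis
    proof (cases "Polynomial.degree f = 0")
      case True
      then have "proots (cpoly f) = {#}"
        by (simp flip: size_eq_0_iff_empty add: size_proots_complex)
      then show ?thesis by simp
    next
      case deg: False
      with False less.prems have "Polynomial.degree r < Polynomial.degree f"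
        unfolding r_def using degree_mod_less by blast
      then have IH: "(\<Prod>c\<in>#proots (cpoly r). poly (cpoly f) c) \<in> \<rat>"
        using less.hyps False by blast
      let ?l = "Polynomial.lead_coeff (cpoly f) ^ Polynomial.degree (cpoly r)"
      have lc: "Polynomial.lead_coeff (cpoly p) \<in> \<rat>" for p
        by simp
      have "?l * (\<Prod>b\<in>#proots (cpoly f). poly (cpoly r) b) \<in> \<rat>"
        unfolding prod_proots_reciprocity by (intro Rats_mult Rats_power IH lc) auto
      then have "?l * (\<Prod>b\<in>#proots (cpoly f). poly (cpoly r) b) / ?l \<in> \<rat>"
        by (intro Rats_divide Rats_power lc)
      moreover have "?l \<noteq> 0" using less.prems by simp
      ultimately show ?thesis unfolding eq by (metis nonzero_mult_div_cancel_left)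
    qed
  qed
qed

text \<open>
At a root \<open>x\<close> of a product of linear factors, the derivative is the product of the
differences of \<open>x\<close> from the other roots. Every unordered pair of roots thus occurs
twice, with opposite signs.
\<close>
lemma prod_pderiv_roots_eq_sq_diff_prod:
  fixes xs :: "complex list"
  defines "F \<equiv> \<lambda>xs :: complex list. \<Prod>x\<leftarrow>xs. [:- x, 1:]"
  shows "\<exists>k. (\<Prod>x\<leftarrow>xs. poly (pderiv (F xs)) x) = (-1) ^ k * sq_diff_prod xs"
proof (induction xs)
  case Nil
  then show ?case by (auto simp: sq_diff_prod_def intro: exI[of _ 0])
next
  case (Cons x xs)
  then obtain k where k: "(\<Prod>x\<leftarrow>xs. poly (pderiv (F xs)) x) = (-1) ^ k * sq_diff_prod xs"
    by blast
  have prod_list_distrib: "(\<Prod>y\<leftarrow>ys. a y * b y) = (\<Prod>y\<leftarrow>ys. a y) * (\<Prod>y\<leftarrow>ys. b y)"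
    for ys and a b :: "complex \<Rightarrow> complex"
    by (induction ys) simp_all
  have F: "poly (F ys) z = (\<Prod>y\<leftarrow>ys. z - y)" for ys z
    by (induction ys) (simp_all add: F_def algebra_simps)
  have d: "poly (pderiv (F (x # xs))) z = poly (F xs) z + (z - x) * poly (pderiv (F xs)) z" for z
  proof -
    have "F (x # xs) = [:- x, 1:] * F xs" by (simp add: F_def)
    then have "pderiv (F (x # xs)) = [:- x, 1:] * pderiv (F xs) + F xs"
      by (simp only: pderiv_mult) (simp add: pderiv_pCons)
    then show ?thesis by (simp only: poly_add poly_mult) (simp add: algebra_simps)
  qed
  have root: "poly (F xs) z = 0" if "z \<in> set xs" for z
    unfolding F using that by (induction xs) auto
  have "(\<Prod>z\<leftarrow>xs. poly (pderiv (F (x # xs))) z) = (\<Prod>z\<leftarrow>xs. (z - x) * poly (pderiv (F xs)) z)"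
    by (intro arg_cong[of _ _ prod_list] map_cong) (auto simp: d root)
  also have "\<dots> = (\<Prod>z\<leftarrow>xs. z - x) * (\<Prod>z\<leftarrow>xs. poly (pderiv (F xs)) z)"
    by (rule prod_list_distrib)
  also have "(\<Prod>z\<leftarrow>xs. z - x) = (-1) ^ length xs * (\<Prod>z\<leftarrow>xs. x - z)"
    by (induction xs) (simp_all add: algebra_simps)
  finally have "(\<Prod>z\<leftarrow>x # xs. poly (pderiv (F (x # xs))) z)
      = (-1) ^ (length xs + k) * ((\<Prod>z\<leftarrow>xs. x - z) ^ 2 * sq_diff_prod xs)"
    by (simp add: d k F power_add power2_eq_square mult_ac)
  also have "(\<Prod>z\<leftarrow>xs. x - z) ^ 2 = prod_list (map (\<lambda>r. (x - r)\<^sup>2) xs)"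
    by (induction xs) (simp_all add: power_mult_distrib)
  finally show ?case unfolding sq_diff_prod_Cons by blast
qed

text \<open>
Up to sign, the squared product of differences of the roots is the product of the values of the
derivative at the roots.
\<close>
lemma sq_diff_prod_proots_rational:
  fixes f :: "rat poly"
  assumes monic: "Polynomial.lead_coeff f = 1" and rs: "mset rs = proots (cpoly f)"
  shows "sq_diff_prod rs \<in> \<rat>"
    and "(\<And>b. poly (cpoly f) b = 0 \<Longrightarrow> poly (cpoly (pderiv f)) b \<noteq> 0) \<Longrightarrow> sq_diff_prod rs \<noteq> 0"
proof -
  have f0: "f \<noteq> 0" using monic by auto
  have "cpoly f = (\<Prod>x\<in>#proots (cpoly f). [:- x, 1:])"
    by (subst complex_poly_decompose_multiset[symmetric]) (simp add: monic)
  also have "\<dots> = (\<Prod>x\<leftarrow>rs. [:- x, 1:])"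
    by (simp add: prod_mset_prod_list flip: rs mset_map)
  finally have F: "(\<Prod>x\<leftarrow>rs. [:- x, 1:]) = cpoly f" by simp
  obtain k where "(\<Prod>x\<leftarrow>rs. poly (pderiv (cpoly f)) x) = (-1) ^ k * sq_diff_prod rs"
    using prod_pderiv_roots_eq_sq_diff_prod[of rs] unfolding F by blast
  then have k: "(\<Prod>b\<in>#proots (cpoly f). poly (cpoly (pderiv f)) b) = (-1) ^ k * sq_diff_prod rs"
    by (simp add: of_rat_hom.map_poly_pderiv flip: rs mset_map prod_mset_prod_list)
  have "(-1) ^ k * ((-1) ^ k * sq_diff_prod rs) \<in> \<rat>"
    unfolding k[symmetric] by (intro Rats_mult prod_proots_rational f0) auto
  then show "sq_diff_prod rs \<in> \<rat>"
    by (simp flip: mult.assoc power_add add: mult_2[symmetric] power_mult)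
  assume "\<And>b. poly (cpoly f) b = 0 \<Longrightarrow> poly (cpoly (pderiv f)) b \<noteq> 0"
  then have "(\<Prod>b\<in>#proots (cpoly f). poly (cpoly (pderiv f)) b) \<noteq> 0"
    using f0 by (auto simp: prod_mset_zero_iff)
  then show "sq_diff_prod rs \<noteq> 0" unfolding k by auto
qed

section \<open>Residues modulo a prime\<close>

lemma residue_eqI:
  fixes a b :: int
  assumes "n dvd a - b" "a \<in> {0..<n}" "b \<in> {0..<n}"
  shows "a = b"
  using assms by (metis atLeastLessThan_iff mod_eq_dvd_iff mod_pos_pos_trivial)

lemma inverse_mod_prime:
  fixes p :: nat and a :: int
  assumes "Factorial_Ring.prime p" "\<not> int p dvd a"
  obtains u t where "u * a = 1 + int p * t"
proof -
  have "Rings.coprime (int p) a" using assms by (intro prime_imp_coprime) auto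
  then obtain t' u where "t' * int p + u * a = 1"
    using bezout_int[of "int p" a] by auto
  then show ?thesis by (intro that[of u "- t'"]) (simp add: algebra_simps)
qed

section \<open>Rational polynomials with a common root\<close>

lemma cpoly_of_int: "cpoly (map_poly of_int p) = map_poly of_int p"
  by (simp add: map_poly_map_poly o_def)

text \<open>
This is Gauss's lemma: the greatest common divisor of \<open>g\<close> and \<open>q\<close> over
the rationals is not constant, as it vanishes at \<open>\<alpha>\<close>, so it gives a
factorisation of \<open>g\<close> over the integers and must be \<open>g\<close> up to a unit.
\<close>
lemma irreducible_dvd_if_common_root:
  fixes g :: "int poly" and q :: "rat poly" and \<alpha> :: complex
  assumes irred: "Factorial_Ring.irreducible g" and deg: "Polynomial.degree g \<ge> 1"
    and root: "poly (map_poly of_int g) \<alpha> = 0" "poly (cpoly q) \<alpha> = 0"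
  shows "map_poly of_int g dvd q"
proof -
  let ?G = "map_poly of_int g :: rat poly"
  define e where "e = gcd ?G q"
  obtain u v where uv: "e = u * ?G + v * q"
    unfolding e_def by (metis bezout_coefficients_fst_snd)
  have e_root: "poly (cpoly e) \<alpha> = 0"
    using root by (simp add: uv cpoly_hom.hom_mult cpoly_hom.hom_add cpoly_of_int)
  have G0: "?G \<noteq> 0" using deg by auto
  then have "e \<noteq> 0" by (simp add: e_def)
  have deg_e: "Polynomial.degree e > 0"
  proof (rule Nat.gr0I)
    assume "Polynomial.degree e = 0"
    then obtain a where "e = [:a:]" by (auto elim: degree_eq_zeroE)
    with e_root \<open>e \<noteq> 0\<close> show False by simp
  qed
  obtain s where s: "?G = e * s" by (metis dvdE e_def gcd_dvd1)
  obtain e' s' where f: "g = e' * s'" "Polynomial.degree e' = Polynomial.degree e"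
      "Polynomial.degree s' = Polynomial.degree s"
    using rat_to_int_factor[OF s] by blast
  have "is_unit s'"
    using Factorial_Ring.irreducibleD[OF irred f(1)] deg_e f(2) by (auto simp: poly_dvd_1)
  then have "Polynomial.degree s = 0" using f(3) by (auto simp: poly_dvd_1)
  moreover have "s \<noteq> 0" using s G0 by auto
  ultimately have "is_unit s" by (simp add: is_unit_iff_degree)
  then have "?G dvd e" using s by (metis mult_unit_dvd_iff dvd_refl)
  then show ?thesis by (simp add: e_def)
qed

section \<open>The monic polynomial with scaled roots\<close>

text \<open>
The monic polynomial \<open>c ^ (d - 1) g (X / c)\<close>, where \<open>c\<close> is the leading
coefficient and \<open>d\<close> the degree of \<open>g\<close>; its roots are those of
\<open>g\<close> multiplied by \<open>c\<close>.
\<close>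
definition monic_scale :: "int poly \<Rightarrow> int poly" where
  "monic_scale g = Polynomial.monom 1 (Polynomial.degree g) +
     (\<Sum>i<Polynomial.degree g. Polynomial.monom
        (Polynomial.coeff g i * Polynomial.lead_coeff g ^ (Polynomial.degree g - 1 - i)) i)"

lemma degree_monic_scale: "Polynomial.degree (monic_scale g) = Polynomial.degree g"
    and monic_monic_scale: "Polynomial.lead_coeff (monic_scale g) = 1"
proof -
  let ?d = "Polynomial.degree g"
  let ?r = "\<Sum>i<?d. Polynomial.monom
        (Polynomial.coeff g i * Polynomial.lead_coeff g ^ (?d - 1 - i)) i"
  have c: "Polynomial.coeff (monic_scale g) n = (if n = ?d then 1 else if n < ?d
      then Polynomial.coeff g n * Polynomial.lead_coeff g ^ (?d - 1 - n) else 0)" for n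
    by (auto simp: monic_scale_def coeff_sum coeff_monom)
  then have "Polynomial.degree (monic_scale g) \<le> ?d" by (intro degree_le) auto
  moreover have "Polynomial.degree (monic_scale g) \<ge> ?d" using c by (intro le_degree) auto
  ultimately show d: "Polynomial.degree (monic_scale g) = ?d" by simp
  then show "Polynomial.lead_coeff (monic_scale g) = 1" using c by simp
qed

lemma poly_monic_scale:
  fixes x :: "'a :: comm_ring_1"
  assumes "Polynomial.degree g \<ge> 1"
  defines "c \<equiv> of_int (Polynomial.lead_coeff g)"
  shows "poly (map_poly of_int (monic_scale g)) (c * x) =
    c ^ (Polynomial.degree g - 1) * poly (map_poly of_int g) x"
proof -
  interpret map_poly_comm_ring_hom "of_int :: int \<Rightarrow> 'a" ..
  let ?d = "Polynomial.degree g"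
  have "poly (map_poly of_int g) x = poly (map_poly of_int (\<Sum>i\<le>?d. Polynomial.monom (Polynomial.coeff g i) i)) x"
    by (simp only: poly_as_sum_of_monoms)
  also have "\<dots> = (\<Sum>i\<le>?d. of_int (Polynomial.coeff g i) * x ^ i)"
    by (simp add: hom_distribs poly_sum poly_monom)
  finally have g: "poly (map_poly of_int g) x = c * x ^ ?d + (\<Sum>i<?d. of_int (Polynomial.coeff g i) * x ^ i)"
    by (simp add: c_def add.commute flip: lessThan_Suc_atMost)
  have "poly (map_poly of_int (monic_scale g)) (c * x) = (c * x) ^ ?d +
      (\<Sum>i<?d. of_int (Polynomial.coeff g i) * c ^ (?d - 1 - i) * (c * x) ^ i)"
    by (simp add: monic_scale_def hom_distribs poly_sum poly_monom c_def)
  also have "(c * x) ^ ?d = c ^ (?d - 1) * (c * x ^ ?d)"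
    using assms(1) by (cases ?d) (simp_all add: power_mult_distrib mult_ac)
  also have "(\<Sum>i<?d. of_int (Polynomial.coeff g i) * c ^ (?d - 1 - i) * (c * x) ^ i) =
      (\<Sum>i<?d. c ^ (?d - 1) * (of_int (Polynomial.coeff g i) * x ^ i))"
  proof (intro sum.cong refl)
    fix i assume "i \<in> {..<?d}"
    then have "c ^ (?d - 1) = c ^ (?d - 1 - i) * c ^ i"
      by (simp flip: power_add)
    then show "of_int (Polynomial.coeff g i) * c ^ (?d - 1 - i) * (c * x) ^ i =
        c ^ (?d - 1) * (of_int (Polynomial.coeff g i) * x ^ i)"
      by (simp add: power_mult_distrib mult_ac)
  qed
  finally show ?thesis by (simp add: g distrib_left sum_distrib_left)
qed

lemma proots_monic_scale:
  fixes g :: "int poly"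
  assumes deg: "Polynomial.degree g \<ge> 1"
    and rs: "mset rs = proots (map_poly of_int g :: complex poly)"
  shows "mset (map ((*) (of_int (Polynomial.lead_coeff g))) rs) = proots (map_poly of_int (monic_scale g))"
proof -
  let ?c = "of_int (Polynomial.lead_coeff g) :: complex"
  let ?A = "image_mset ((*) ?c) (mset rs)"
  have c0: "?c \<noteq> 0" using deg by auto
  have len: "length rs = Polynomial.degree g"
    using size_proots_complex[of "map_poly of_int g"] by (simp flip: rs)
  have "poly (map_poly of_int (monic_scale g)) z = poly (\<Prod>x\<in>#?A. [:- x, 1:]) z" for z
  proof -
    have "poly (map_poly of_int (monic_scale g)) z =
        ?c ^ (Polynomial.degree g - 1) * poly (map_poly of_int g) (z / ?c)"
      using poly_monic_scale[OF deg, of "z / ?c"] c0 by simp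
    also have "\<dots> = ?c ^ (Polynomial.degree g - 1) * (?c * (\<Prod>b\<in>#mset rs. z / ?c - b))"
      by (subst poly_eq_prod_proots) (simp add: rs)
    also have "\<dots> = ?c ^ length rs * (\<Prod>b\<in>#mset rs. z / ?c - b)"
      using deg by (cases "Polynomial.degree g") (simp_all add: len)
    also have "\<dots> = (\<Prod>b\<in>#mset rs. z - ?c * b)"
      using c0 by (induction rs) (simp_all add: field_simps)
    also have "\<dots> = poly (\<Prod>x\<in>#?A. [:- x, 1:]) z"
      by (simp add: poly_prod_mset image_mset.compositionality o_def)
    finally show ?thesis .
  qed
  then have "map_poly of_int (monic_scale g) = (\<Prod>x\<in>#?A. [:- x, 1:])"
    using poly_eq_poly_eq_iff by blast
  moreover have "proots (\<Prod>x\<in>#A. [:- x, 1:]) = A" for A :: "complex multiset"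
  proof (induction A)
    case (add x A)
    have "(\<Prod>x\<in>#A. [:- x, 1:]) \<noteq> 0" by (auto simp: prod_mset_zero_iff)
    then show ?case using add proots_linear_factor[of "- x"] by (simp add: proots_mult del: mult_pCons_left proots_linear_factor)
  qed simp
  ultimately show ?thesis by simp
qed

lemma sq_diff_prod_scale:
  "sq_diff_prod (map ((*) c) rs) = c ^ (length rs * (length rs - 1)) * sq_diff_prod rs"
proof (induction rs)
  case Nil
  then show ?case by (simp add: sq_diff_prod_def)
next
  case (Cons x rs)
  have "prod_list (map (\<lambda>r. (c * x - r)\<^sup>2) (map ((*) c) rs)) =
      c ^ (length rs + length rs) * prod_list (map (\<lambda>r. (x - r)\<^sup>2) rs)"
    by (induction rs) (simp_all add: power_mult_distrib power2_eq_square flip: right_diff_distrib)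
  moreover have "length (x # rs) * (length (x # rs) - 1) = length rs + length rs + length rs * (length rs - 1)"
    by (cases rs) simp_all
  ultimately show ?case
    unfolding sq_diff_prod_Cons list.map Cons.IH by (simp add: power_add mult_ac)
qed

text \<open>
The roots are multiplied by \<open>c\<close>, so the \<open>d (d - 1) / 2\<close> squared
differences gain \<open>c ^ (d (d - 1))\<close>, of which the discriminant of \<open>g\<close>
already contains \<open>c ^ (2 d - 2)\<close>.
\<close>
lemma sq_diff_prod_monic_scale:
  fixes g :: "int poly"
  assumes deg: "Polynomial.degree g \<ge> 1"
    and rs: "mset rs = proots (map_poly of_int (monic_scale g) :: complex poly)"
  shows "sq_diff_prod rs = of_int (Polynomial.lead_coeff g) ^ ((Polynomial.degree g - 1) * (Polynomial.degree g - 2)) *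
    discriminant (map_poly of_int g)"
proof -
  let ?c = "of_int (Polynomial.lead_coeff g) :: complex"
  let ?d = "Polynomial.degree g"
  obtain rs' where rs': "mset rs' = proots (map_poly of_int g :: complex poly)"
    using ex_mset by blast
  have len: "length rs' = ?d"
    using size_proots_complex[of "map_poly of_int g"] by (simp flip: rs')
  have "sq_diff_prod rs = sq_diff_prod (map ((*) ?c) rs')"
    using proots_monic_scale[OF deg rs'] rs by (intro sq_diff_prod_cong) simp
  also have "\<dots> = ?c ^ (?d * (?d - 1)) * sq_diff_prod rs'"
    by (simp add: sq_diff_prod_scale len)
  also have "?d * (?d - 1) = (?d - 1) * (?d - 2) + (2 * ?d - 2)"
  proof -
    consider "?d = 1" | k where "?d = Suc (Suc k)" using deg
      by (metis One_nat_def Suc_le_D not0_implies_Suc)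
    then show ?thesis by cases simp_all
  qed
  finally show ?thesis
    using rs' by (simp add: discriminant_eq[OF rs'] power_add)
qed

section \<open>Integer relations from linear dependence\<close>

interpretation rat_vs: vector_space "\<lambda>(r :: rat) (z :: complex). of_rat r * z"
  by unfold_locales (simp_all add: algebra_simps of_rat_add of_rat_mult)

text \<open>
Turns a rational linear relation into one that survives reduction modulo \<open>p\<close>: the
denominators are cleared, and the resulting integers are divided by their greatest common
divisor.
\<close>
lemma clear_denominators_primitively:
  fixes u :: "'a \<Rightarrow> rat"
  assumes S: "finite S" and s0: "s\<^sub>0 \<in> S" "u s\<^sub>0 \<noteq> 0" and p: "Factorial_Ring.prime (p :: int)"
  obtains t a where "t \<noteq> 0" "\<And>s. s \<in> S \<Longrightarrow> of_int (a s) = t * u s" "\<exists>s\<in>S. \<not> p dvd a s"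
proof -
  define b where "b = (\<lambda>s. snd (quotient_of (u s)))"
  define N where "N = (\<Prod>s\<in>S. b s)"
  have b: "b s > 0" for s by (simp add: b_def quotient_of_denom_pos')
  then have N: "N > 0" unfolding N_def by (intro prod_pos) auto
  define a0 where "a0 = (\<lambda>s. (\<Prod>s'\<in>S - {s}. b s') * fst (quotient_of (u s)))"
  have a0: "of_int (a0 s) = of_int N * u s" if "s \<in> S" for s
  proof -
    have u: "u s = of_int (fst (quotient_of (u s))) / of_int (b s)"
      unfolding b_def by (metis prod.collapse quotient_of_div)
    have "N = b s * (\<Prod>s'\<in>S - {s}. b s')"
      unfolding N_def using S that by (rule prod.remove)
    then show ?thesis using b[of s] by (subst u) (simp add: a0_def)
  qed
  define G where "G = Gcd (a0 ` S)"
  have "a0 s\<^sub>0 \<noteq> 0" using a0[OF s0(1)] s0(2) N by auto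
  then have G: "G \<noteq> 0" using s0(1) by (auto simp: G_def Gcd_0_iff)
  have dvd: "G dvd a0 s" if "s \<in> S" for s using that by (simp add: G_def)
  show ?thesis
  proof
    show "of_int N / of_int G \<noteq> (0 :: rat)" using N G by simp
    show "of_int (a0 s div G) = of_int N / of_int G * u s" if "s \<in> S" for s
      using a0[OF that] dvd[OF that] G by (simp add: of_int_div)
    show "\<exists>s\<in>S. \<not> p dvd a0 s div G"
    proof (rule ccontr)
      assume "\<not> ?thesis"
      then have "p * G dvd a0 s" if "s \<in> S" for s
        using that dvd[OF that] G by (metis dvd_div_iff_mult mult.commute)
      then have "p * G dvd Gcd (a0 ` S)" by (intro Gcd_greatest) auto
      then have "p * G dvd G" by (simp only: G_def)
      then have "p dvd 1" using G by (metis dvd_mult_cancel_right mult_1)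
      then show False using p by (simp add: prime_int_iff not_prime_unit)
    qed
  qed
qed

section \<open>The number field of an algebraic integer\<close>

lemma map_pCons_simps:
  "cpoly (pCons a p) = pCons (of_rat a) (cpoly p)"
  "map_poly of_int (pCons b q) = pCons (of_int b :: 'a :: ring_1) (map_poly of_int q)"
  by (simp_all add: poly_eq_iff coeff_map_poly coeff_pCons split: nat.splits)

lemma poly_cpoly_smult: "poly (cpoly (Polynomial.smult r p)) z = of_rat r * poly (cpoly p) z"
  by (induction p) (simp_all add: map_pCons_simps of_rat_mult algebra_simps)

lemma poly_cpoly_pcompose: "poly (cpoly (pcompose p q)) z = poly (cpoly p) (poly (cpoly q) z)"
  by (induction p)
     (simp_all add: map_pCons_simps pcompose_pCons cpoly_hom.hom_add cpoly_hom.hom_mult)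

lemma monic_division:
  fixes f h :: "int poly"
  assumes "Polynomial.lead_coeff h = 1"
  obtains q r where "f = h * q + r" "r = 0 \<or> Polynomial.degree r < Polynomial.degree h"
proof -
  obtain q r where qr: "pseudo_divmod f h = (q, r)" by (metis surj_pair)
  have "h \<noteq> 0" using assms by auto
  from pseudo_divmod[OF this qr] show ?thesis
    using that[of q r] assms by simp
qed

lemma subfield_complexI:
  assumes "1 \<in> F" "\<And>x y. x \<in> F \<Longrightarrow> y \<in> F \<Longrightarrow> x + y \<in> F" "\<And>x. x \<in> F \<Longrightarrow> - x \<in> F"
    "\<And>x y. x \<in> F \<Longrightarrow> y \<in> F \<Longrightarrow> x * y \<in> F" "\<And>x. x \<in> F \<Longrightarrow> x \<noteq> 0 \<Longrightarrow> inverse x \<in> F"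
    "H \<subseteq> F"
  shows "generate_field (ring_of_type_algebra :: complex ring) H \<subseteq> F"
proof -
  let ?C = "ring_of_type_algebra :: complex ring"
  interpret C: Ring.field ?C by (rule field_from_type_algebra)
  have m: "\<ominus>\<^bsub>?C\<^esub> x = - x" for x
    by (rule C.minus_equality) (auto simp: ring_of_type_algebra_def)
  have i: "inv\<^bsub>?C\<^esub> x = inverse x" if "x \<noteq> 0" for x
    by (rule C.comm_inv_char) (use that in \<open>auto simp: ring_of_type_algebra_def\<close>)
  have ops: "\<one>\<^bsub>?C\<^esub> = 1" "\<zero>\<^bsub>?C\<^esub> = 0" "x \<oplus>\<^bsub>?C\<^esub> y = x + y" "x \<otimes>\<^bsub>?C\<^esub> y = x * y" for x y
    by (auto simp: ring_of_type_algebra_def)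
  show ?thesis
  proof
    show "x \<in> F" if "x \<in> generate_field ?C H" for x
      using that
    proof (induction rule: generate_field.induct)
      case (m_inv x)
      then show ?case using assms by (simp add: i ops)
    qed (use assms in \<open>auto simp: m ops\<close>)
  qed
qed

lemma rat_adjoin_closed:
  shows "of_rat r \<in> rat_adjoin \<alpha>" and "\<alpha> \<in> rat_adjoin \<alpha>"
    and "x \<in> rat_adjoin \<alpha> \<Longrightarrow> y \<in> rat_adjoin \<alpha> \<Longrightarrow> x + y \<in> rat_adjoin \<alpha>"
    and "x \<in> rat_adjoin \<alpha> \<Longrightarrow> y \<in> rat_adjoin \<alpha> \<Longrightarrow> x * y \<in> rat_adjoin \<alpha>"
  using generate_field.eng_add[of x "ring_of_type_algebra :: complex ring" "insert \<alpha> \<rat>" y]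
    generate_field.eng_mult[of x "ring_of_type_algebra :: complex ring" "insert \<alpha> \<rat>" y]
    generate_field.incl[of _ "insert \<alpha> \<rat>" "ring_of_type_algebra :: complex ring"]
  by (auto simp: rat_adjoin_def ring_of_type_algebra_def)

text \<open>
An algebraic integer \<open>\<beta>\<close> together with its monic minimal polynomial
\<open>h\<close>. Minimality is stated over the rationals, in the form in which all consequences
of irreducibility are drawn below.
\<close>
locale monic_generator =
  fixes h :: "int poly" and \<beta> :: complex
  assumes monic: "Polynomial.lead_coeff h = 1"
    and deg_pos: "Polynomial.degree h \<ge> 1"
    and root: "poly (map_poly of_int h) \<beta> = 0"
    and minimal: "\<And>q. poly (cpoly q) \<beta> = 0 \<Longrightarrow> map_poly of_int h dvd q"
begin

abbreviation d :: nat where "d \<equiv> Polynomial.degree h"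

text \<open>
The image of \<open>ev\<close> is the order \<open>\<int>[\<beta>]\<close>.
\<close>
abbreviation ev :: "int poly \<Rightarrow> complex" where "ev q \<equiv> poly (map_poly of_int q) \<beta>"

definition K :: "complex set" where "K = range (\<lambda>q. poly (cpoly q) \<beta>)"

definition R :: "complex set" where "R = {z \<in> K. algebraic_int z}"

lemma K_I: "poly (cpoly q) \<beta> \<in> K"
  by (simp add: K_def)

lemma ev_in_K: "ev q \<in> K"
  using K_I[of "map_poly of_int q"] by (simp add: cpoly_of_int)

lemma K_closed:
  shows "1 \<in> K" "of_int n \<in> K" "of_rat a \<in> K" "\<beta> \<in> K" and
    "x \<in> K \<Longrightarrow> y \<in> K \<Longrightarrow> x + y \<in> K" "x \<in> K \<Longrightarrow> - x \<in> K"
    "x \<in> K \<Longrightarrow> y \<in> K \<Longrightarrow> x * y \<in> K"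
proof -
  show "1 \<in> K" using ev_in_K[of 1] by simp
  show "of_int n \<in> K" using ev_in_K[of "[:n:]"] by (simp add: map_pCons_simps)
  show "of_rat a \<in> K" using K_I[of "[:a:]"] by (simp add: map_pCons_simps)
  show "\<beta> \<in> K" using ev_in_K[of "[:0, 1:]"] by (simp add: map_pCons_simps)
  show "x + y \<in> K" if xy: "x \<in> K" "y \<in> K"
  proof -
    obtain p q where "x = poly (cpoly p) \<beta>" "y = poly (cpoly q) \<beta>" using xy by (auto simp: K_def)
    then show ?thesis using K_I[of "p + q"] by (simp add: cpoly_hom.hom_add)
  qed
  show "- x \<in> K" if x: "x \<in> K"
  proof -
    obtain p where "x = poly (cpoly p) \<beta>" using x by (auto simp: K_def)
    then show ?thesis using K_I[of "- p"] by (simp add: cpoly_hom.hom_uminus)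
  qed
  show "x * y \<in> K" if xy: "x \<in> K" "y \<in> K"
  proof -
    obtain p q where "x = poly (cpoly p) \<beta>" "y = poly (cpoly q) \<beta>" using xy by (auto simp: K_def)
    then show ?thesis using K_I[of "p * q"] by (simp add: cpoly_hom.hom_mult)
  qed
qed

lemma root_of_h_rat: "poly (cpoly (map_poly of_int h)) \<beta> = 0"
  by (simp add: cpoly_of_int root)

text \<open>
If \<open>x\<close> is the value of \<open>q\<close> at \<open>\<beta>\<close> and is nonzero,
then \<open>q\<close> is coprime to \<open>h\<close>, and a Bezout identity evaluated at
\<open>\<beta>\<close> exhibits the inverse.
\<close>
lemma K_inverse:
  assumes "x \<in> K" "x \<noteq> 0"
  shows "inverse x \<in> K"
proof -
  obtain q where x: "x = poly (cpoly q) \<beta>" using assms by (auto simp: K_def)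
  let ?H = "map_poly of_int h :: rat poly"
  define e where "e = gcd ?H q"
  obtain u v where uv: "e = u * ?H + v * q"
    unfolding e_def by (metis bezout_coefficients_fst_snd)
  then have e_val: "poly (cpoly e) \<beta> = poly (cpoly v) \<beta> * x"
    by (simp add: cpoly_hom.hom_mult cpoly_hom.hom_add root_of_h_rat x)
  have e0: "poly (cpoly e) \<beta> \<noteq> 0"
  proof
    assume "poly (cpoly e) \<beta> = 0"
    moreover obtain s where "q = e * s" by (metis dvdE e_def gcd_dvd2)
    ultimately show False using assms x by (simp add: cpoly_hom.hom_mult)
  qed
  have H0: "?H \<noteq> 0" using monic by auto
  obtain s where s: "?H = e * s" by (metis dvdE e_def gcd_dvd1)
  then have "poly (cpoly s) \<beta> = 0"
    using root_of_h_rat e0 by (simp add: cpoly_hom.hom_mult)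
  then have "Polynomial.degree ?H \<le> Polynomial.degree s"
    using minimal s H0 by (intro dvd_imp_degree_le) auto
  then have "Polynomial.degree e = 0"
    using s H0 by (simp add: degree_mult_eq)
  then obtain a where a: "e = [:a:]" by (auto elim: degree_eq_zeroE)
  with e0 e_val have "of_rat a = poly (cpoly v) \<beta> * x" "a \<noteq> 0"
    by (auto simp: map_pCons_simps)
  then have "inverse x = of_rat (inverse a) * poly (cpoly v) \<beta>"
    using e0 e_val by (simp add: of_rat_inverse)
  then show ?thesis by (simp add: K_closed K_I)
qed

lemma rat_adjoin_eq_K:
  assumes "c \<noteq> 0" "\<beta> = of_int c * \<alpha>"
  shows "rat_adjoin \<alpha> = K"
proof
  have "\<alpha> = of_rat (inverse (of_int c)) * \<beta>"
    using assms by (simp add: of_rat_inverse)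
  then have "\<alpha> \<in> K" by (metis K_closed(3,4,7))
  then show "rat_adjoin \<alpha> \<subseteq> K" unfolding rat_adjoin_def
    by (intro subfield_complexI) (auto simp: K_closed K_inverse Rats_def)
  have "\<beta> = of_rat (of_int c) * \<alpha>" using assms by simp
  then have beta: "\<beta> \<in> rat_adjoin \<alpha>" using rat_adjoin_closed by metis
  have "poly (cpoly q) \<beta> \<in> rat_adjoin \<alpha>" for q
  proof (induction q)
    case 0
    then show ?case using rat_adjoin_closed(1)[of 0] by simp
  next
    case (pCons a q)
    then show ?case
      by (simp add: rat_adjoin_closed beta map_pCons_simps)
  qed
  then show "K \<subseteq> rat_adjoin \<alpha>" by (auto simp: K_def)
qed

lemma R_closed:
  shows "0 \<in> R" "1 \<in> R" "of_int n \<in> R" "of_nat m \<in> R"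
    "x \<in> R \<Longrightarrow> y \<in> R \<Longrightarrow> x + y \<in> R" "x \<in> R \<Longrightarrow> - x \<in> R"
    "x \<in> R \<Longrightarrow> y \<in> R \<Longrightarrow> x * y \<in> R" "x \<in> R \<Longrightarrow> y \<in> R \<Longrightarrow> x - y \<in> R"
  using K_closed(2)[of 0] K_closed(2)[of "int m"] K_closed(5)[of x "- y"]
  by (auto simp: R_def K_closed algebraic_int_add_mult algebraic_int_diff algebraic_int_minus)

lemma poly_in_R: "z \<in> R \<Longrightarrow> poly (map_poly of_int q) z \<in> R"
  by (induction q) (auto simp: R_closed map_pCons_simps)

lemma beta_in_R: "\<beta> \<in> R"
  unfolding R_def algebraic_int_altdef_ipoly using K_closed(4) root monic by blast

lemma ev_in_R: "ev q \<in> R"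
  by (rule poly_in_R[OF beta_in_R])

lemma ev_algebra:
  "ev (s + t) = ev s + ev t" "ev (s * t) = ev s * ev t" "ev (Polynomial.smult n s) = of_int n * ev s"
  "ev 1 = 1" "ev 0 = 0" "ev [:n:] = of_int n" "ev (s - t) = ev s - ev t"
  by (simp_all add: hom_distribs map_pCons_simps)

lemma R_power: "z \<in> R \<Longrightarrow> z ^ n \<in> R"
  by (induction n) (auto simp: R_closed)

lemma dvd_if_ev_eq_0:
  assumes "ev q = 0"
  shows "h dvd q"
proof -
  obtain s r where q: "q = h * s + r" "r = 0 \<or> Polynomial.degree r < d"
    by (rule monic_division[OF monic])
  then have "ev r = 0" using assms root
    by (simp add: of_int_poly_hom.hom_add of_int_poly_hom.hom_mult)
  then have "map_poly of_int h dvd (map_poly of_int r :: rat poly)"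
    by (intro minimal) (simp add: cpoly_of_int)
  then have "r = 0" using q(2) by (auto dest: dvd_imp_degree_le)
  then show ?thesis using q by simp
qed

text \<open>
Makes reduction at a root \<open>b\<close> of \<open>h\<close> modulo \<open>p\<close> well
defined on \<open>\<int>[\<beta>]\<close>: the value of \<open>q\<close> at \<open>b\<close>
modulo \<open>p\<close> depends only on \<open>ev q\<close>.
\<close>
lemma ev_cong_roots:
  assumes "ev q = ev r" "p dvd poly h b"
  shows "p dvd poly q b - poly r b"
proof -
  have "ev (q - r) = 0" using assms by (simp add: of_int_poly_hom.hom_minus)
  then obtain s where "q - r = h * s" using dvd_if_ev_eq_0 by (metis dvdE)
  then have "poly q b - poly r b = poly h b * poly s b"
    by (metis poly_diff poly_mult)
  then show ?thesis using assms by simp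
qed

lemma ev_reduce:
  obtains r where "ev q = ev r" "Polynomial.degree r < d"
proof -
  obtain s r where q: "q = h * s + r" "r = 0 \<or> Polynomial.degree r < d"
    by (rule monic_division[OF monic])
  then have "ev q = ev r" using root
    by (simp add: of_int_poly_hom.hom_add of_int_poly_hom.hom_mult)
  moreover have "Polynomial.degree r < d" using q(2) deg_pos by auto
  ultimately show ?thesis by (rule that)
qed

lemma K_denominator:
  assumes "z \<in> K"
  obtains n q where "n > 0" "of_nat n * z = ev q"
proof -
  obtain q where z: "z = poly (cpoly q) \<beta>" using assms by (auto simp: K_def)
  obtain r p where rp: "rat_to_normalized_int_poly q = (r, p)" by (metis surj_pair)
  then have q: "q = Polynomial.smult r (map_poly of_int p)" by (rule rat_to_normalized_int_poly)
  obtain a b where ab: "b > 0" "r = of_int a / of_int b"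
    by (metis quotient_of_denom_pos' quotient_of_div surj_pair snd_conv)
  have "ev (Polynomial.smult a p) = of_int a * ev p"
    by (simp add: hom_distribs)
  then have "of_nat (nat b) * z = ev (Polynomial.smult a p)"
    using ab by (simp add: z q poly_cpoly_smult of_rat_divide cpoly_of_int)
  then show ?thesis using ab(1) that[of "nat b"] by simp
qed

lemma poly_at_conjugate_root:
  assumes "poly (cpoly q) \<beta> = 0" "poly (map_poly of_int h) b = 0"
  shows "poly (cpoly q) b = 0"
proof -
  obtain s where "q = map_poly of_int h * s" using minimal[OF assms(1)] by (metis dvdE)
  then show ?thesis using assms(2) by (simp add: cpoly_hom.hom_mult cpoly_of_int)
qed

text \<open>
If \<open>m\<close> is a monic integer polynomial with root \<open>q \<beta>\<close>, then
\<open>m (q X)\<close> vanishes at \<open>\<beta>\<close>, hence is divisible by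
\<open>h\<close> and vanishes at every other root \<open>b\<close> of \<open>h\<close>.
\<close>
lemma algebraic_int_conjugate:
  assumes "algebraic_int (poly (cpoly q) \<beta>)" "poly (map_poly of_int h) b = 0"
  shows "algebraic_int (poly (cpoly q) b)"
proof -
  obtain m :: "int poly" where m: "poly (map_poly of_int m) (poly (cpoly q) \<beta>) = 0"
      "Polynomial.lead_coeff m = 1"
    using assms(1) unfolding algebraic_int_altdef_ipoly by blast
  have comp: "poly (cpoly (pcompose (map_poly of_int m) q)) z = poly (map_poly of_int m) (poly (cpoly q) z)" for z
    by (simp add: poly_cpoly_pcompose cpoly_of_int)
  have "poly (map_poly of_int m) (poly (cpoly q) b) = 0"
    unfolding comp[symmetric] by (rule poly_at_conjugate_root) (use m assms comp in simp_all)
  then show ?thesis unfolding algebraic_int_altdef_ipoly using m(2) by blast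
qed

lemma K_subset_span: "K \<subseteq> rat_vs.span ((\<lambda>i. \<beta> ^ i) ` {..<d})"
proof
  fix z assume "z \<in> K"
  then obtain n q where nq: "n > 0" "of_nat n * z = ev q" by (rule K_denominator)
  obtain r where r: "ev q = ev r" "Polynomial.degree r < d" by (rule ev_reduce)
  have "z = of_rat (1 / of_nat n) * (of_nat n * z)"
    using nq(1) by (simp add: of_rat_divide)
  also have "of_nat n * z = (\<Sum>i\<le>Polynomial.degree r. of_rat (of_int (Polynomial.coeff r i)) * \<beta> ^ i)"
    unfolding nq(2) r(1) by (simp add: poly_altdef)
  also have "of_rat (1 / of_nat n) * \<dots> \<in> rat_vs.span ((\<lambda>i. \<beta> ^ i) ` {..<d})"
    using r(2) by (intro rat_vs.span_scale rat_vs.span_sum rat_vs.span_base) auto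
  finally show "z \<in> rat_vs.span ((\<lambda>i. \<beta> ^ i) ` {..<d})" .
qed

text \<open>
The first \<open>d\<close> powers of \<open>\<beta>\<close> span \<open>K\<close> over the
rationals. All bounds by \<open>d\<close> on prime ideals and residue rings below rest on this
lemma.
\<close>
lemma integer_relation:
  assumes S: "finite S" "S \<subseteq> K" "card S > d" and p: "Factorial_Ring.prime (p :: int)"
  obtains a where "(\<Sum>s\<in>S. of_int (a s) * s) = 0" "\<exists>s\<in>S. \<not> p dvd a s"
proof -
  have "rat_vs.dependent S"
  proof (rule ccontr)
    assume "\<not> rat_vs.dependent S"
    then have "card S \<le> card ((\<lambda>i. \<beta> ^ i) ` {..<d})"
      using rat_vs.independent_span_bound[of "(\<lambda>i. \<beta> ^ i) ` {..<d}" S] S K_subset_span by auto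
    also have "\<dots> \<le> d" using card_image_le[of "{..<d}" "\<lambda>i. \<beta> ^ i"] by simp
    finally show False using S(3) by simp
  qed
  then obtain u s0 where u: "s0 \<in> S" "u s0 \<noteq> 0" "(\<Sum>s\<in>S. of_rat (u s) * s) = 0"
    using rat_vs.dependent_finite[OF S(1)] by auto
  obtain t a where ta: "t \<noteq> 0" "\<And>s. s \<in> S \<Longrightarrow> of_int (a s) = t * u s" "\<exists>s\<in>S. \<not> p dvd a s"
    by (rule clear_denominators_primitively[of S s0 u p, OF S(1) u(1,2) p]) blast
  have "of_int (a s) = (of_rat t * of_rat (u s) :: complex)" if "s \<in> S" for s
    using arg_cong[OF ta(2)[OF that], of "of_rat :: rat \<Rightarrow> complex"] by (simp add: of_rat_mult)
  then have "(\<Sum>s\<in>S. of_int (a s) * s) = of_rat t * (\<Sum>s\<in>S. of_rat (u s) * s)"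
    by (simp add: sum_distrib_left mult_ac)
  then show ?thesis using that u(3) ta(3) by simp
qed

section \<open>Denominators prime to the discriminant\<close>

text \<open>
If \<open>h\<close> and its derivative had a common root, their greatest common divisor would be
a nonconstant divisor of \<open>h\<close>. As \<open>h\<close> is irreducible, that divisor
would be \<open>h\<close> itself, which cannot divide a nonzero polynomial of smaller degree.
\<close>
lemma simple_roots:
  assumes b: "poly (map_poly of_int h) b = 0"
  shows "poly (cpoly (pderiv (map_poly of_int h))) b \<noteq> 0"
proof
  let ?H = "map_poly of_int h :: rat poly"
  assume b': "poly (cpoly (pderiv ?H)) b = 0"
  define e where "e = gcd ?H (pderiv ?H)"
  obtain u v where "e = u * ?H + v * pderiv ?H"
    unfolding e_def by (metis bezout_coefficients_fst_snd)
  then have eb: "poly (cpoly e) b = 0"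
    using b b' by (simp add: cpoly_hom.hom_mult cpoly_hom.hom_add cpoly_of_int)
  have H0: "?H \<noteq> 0" using monic by auto
  then have e0: "e \<noteq> 0" by (simp add: e_def)
  have deg_e: "Polynomial.degree e \<noteq> 0"
  proof
    assume "Polynomial.degree e = 0"
    then obtain a where "e = [:a:]" by (auto elim: degree_eq_zeroE)
    with eb e0 show False by (simp add: map_pCons_simps)
  qed
  obtain s where s: "?H = e * s" by (metis dvdE e_def gcd_dvd1)
  then have "poly (cpoly e) \<beta> = 0 \<or> poly (cpoly s) \<beta> = 0"
    using root_of_h_rat by (simp add: cpoly_hom.hom_mult)
  then show False
  proof
    assume "poly (cpoly e) \<beta> = 0"
    then have "?H dvd pderiv ?H"
      using minimal[of e] by (metis dvd_trans e_def gcd_dvd2)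
    moreover have "Polynomial.degree (pderiv ?H) < Polynomial.degree ?H" "pderiv ?H \<noteq> 0"
      using deg_pos by (simp_all add: degree_pderiv pderiv_eq_0_iff)
    ultimately show False by (auto dest: dvd_imp_degree_le)
  next
    assume "poly (cpoly s) \<beta> = 0"
    then have "Polynomial.degree ?H \<le> Polynomial.degree s"
      using minimal s H0 by (intro dvd_imp_degree_le) auto
    then show False using s H0 deg_e by (simp add: degree_mult_eq)
  qed
qed

text \<open>
The prime \<open>p\<close> does not divide the index of \<open>\<int>[\<beta>]\<close> in the
ring of integers, since otherwise \<open>p\<^sup>2\<close> would divide the discriminant of
\<open>h\<close>, a nonzero integer of absolute value less than \<open>p\<^sup>2\<close>. A
counterexample is first brought into the form \<open>f \<beta>\<close>, with \<open>f\<close> of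
degree \<open>k < d\<close> and leading coefficient \<open>1 / p\<close>; then interpolation at
the roots of \<open>h\<close> applies.
\<close>
lemma no_p_denominators:
  assumes p: "Factorial_Ring.prime (p :: nat)"
    and rs: "mset rs = proots (map_poly of_int h)" and disc: "cmod (sq_diff_prod rs) < (real p)\<^sup>2"
    and z: "algebraic_int z" "of_nat p * z = ev q"
  shows "z \<in> range ev"
proof (rule ccontr)
  assume contr: "z \<notin> range ev"
  have p0: "p > 0" using p by (simp add: prime_gt_0_nat)
  obtain r where r: "ev q = ev r" "Polynomial.degree r < d" by (rule ev_reduce)
  \<comment> \<open>Subtracting an element of \<open>\<int>[\<beta>]\<close> leaves a numerator \<open>q1\<close> with coefficients in \<open>{0..<p}\<close>, so that
    its leading coefficient \<open>a\<close> is prime to \<open>p\<close>.\<close>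
  define q1 where "q1 = map_poly (\<lambda>a. a mod int p) r"
  define q2 where "q2 = map_poly (\<lambda>a. a div int p) r"
  have r_split: "r = q1 + Polynomial.smult (int p) q2"
    by (simp add: poly_eq_iff q1_def q2_def coeff_map_poly)
  define w where "w = z - ev q2"
  have pw: "of_nat p * w = ev q1"
    using z(2) by (simp add: w_def r_split r(1) ev_algebra(1,3) algebra_simps)
  have w_int: "algebraic_int w"
    unfolding w_def using z(1) ev_in_R[of q2] by (intro algebraic_int_diff) (auto simp: R_def)
  have "q1 \<noteq> 0"
  proof
    assume "q1 = 0"
    then have "z = ev q2" using pw p0 by (simp add: w_def)
    with contr show False by blast
  qed
  define k where "k = Polynomial.degree q1"
  define a where "a = Polynomial.lead_coeff q1"
  have k: "k < d" using r(2) degree_map_poly_le[of "\<lambda>a. a mod int p" r] by (simp add: k_def q1_def)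
  have "a \<noteq> 0" using \<open>q1 \<noteq> 0\<close> by (simp add: a_def)
  moreover have "a \<in> {0..<int p}"
    using p0 by (simp add: a_def q1_def coeff_map_poly)
  ultimately have "\<not> int p dvd a" by (auto dest: zdvd_imp_le)
  then obtain u t where ut: "u * a = 1 + int p * t" by (rule inverse_mod_prime[OF p])
  \<comment> \<open>Multiplying by an inverse \<open>u\<close> of \<open>a\<close> modulo \<open>p\<close>, and correcting by a multiple of \<open>p \<beta> ^ k\<close>, makes
    the leading coefficient of the numerator equal to \<open>1\<close>.\<close>
  define s where "s = Polynomial.smult u q1 - Polynomial.smult (int p * t) (Polynomial.monom 1 k)"
  define w' where "w' = of_int u * w - of_int t * \<beta> ^ k"
  have ev_s: "ev s = of_nat p * w'"
    by (simp add: s_def w'_def hom_distribs ev_algebra(3) pw[symmetric] poly_monom algebra_simps)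
  have "algebraic_int (\<beta> ^ k)" using R_power[OF beta_in_R, of k] by (simp add: R_def)
  then have w'_int: "algebraic_int w'"
    unfolding w'_def using w_int by (intro algebraic_int_diff algebraic_int_add_mult) auto
  define f where "f = Polynomial.smult (1 / of_nat p) (map_poly of_int s :: rat poly)"
  have f_w': "poly (cpoly f) \<beta> = w'"
    using p0 by (simp add: f_def poly_cpoly_smult cpoly_of_int ev_s of_rat_divide)
  have s_deg: "Polynomial.degree s \<le> k"
    unfolding s_def k_def
    by (intro degree_diff_le order.trans[OF degree_smult_le] order.trans[OF degree_monom_le]) simp_all
  have s_coeff: "Polynomial.coeff s k = 1"
    using ut by (simp add: s_def a_def k_def)
  have "algebraic_int ((Polynomial.coeff (cpoly f) k)\<^sup>2 * sq_diff_prod rs)"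
  proof (rule algebraic_int_coeff_sq_diff_prod)
    show "Polynomial.degree (cpoly f) \<le> k" using s_deg by (simp add: f_def)
    show "k < length rs"
      using k size_proots_complex[of "map_poly of_int h"] by (simp flip: rs)
    fix b assume "b \<in> set rs"
    then have "b \<in># proots (map_poly of_int h)" by (simp flip: rs)
    moreover have "h \<noteq> 0" using monic by auto
    ultimately have b: "poly (map_poly of_int h) b = 0" by simp
    show "algebraic_int b"
      unfolding algebraic_int_altdef_ipoly using b monic by blast
    show "algebraic_int (poly (cpoly f) b)"
      by (rule algebraic_int_conjugate[OF _ b]) (simp add: f_w' w'_int)
  qed
  then have "algebraic_int (sq_diff_prod rs / of_nat (p\<^sup>2))"
    by (simp add: f_def s_coeff of_rat_divide power_divide)
  moreover have disc_rat: "sq_diff_prod rs \<in> \<rat>"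
    and disc_nz: "sq_diff_prod rs \<noteq> 0"
    using sq_diff_prod_proots_rational[of "map_poly of_int h" rs] monic rs simple_roots
    by (simp_all add: cpoly_of_int)
  ultimately have "sq_diff_prod rs / of_nat (p\<^sup>2) \<in> \<int>"
    by (intro rational_algebraic_int_is_int) auto
  then obtain n where "sq_diff_prod rs / of_nat (p\<^sup>2) = of_int n" by (auto elim: Ints_cases)
  then have n: "sq_diff_prod rs = of_int n * of_nat (p\<^sup>2)" using p0 by (simp add: field_simps)
  then have "n \<noteq> 0" using disc_nz by auto
  then have "1 * (real p)\<^sup>2 \<le> \<bar>of_int n\<bar> * (real p)\<^sup>2"
    by (intro mult_right_mono) auto
  also have "\<dots> = cmod (sq_diff_prod rs)" by (simp add: n norm_mult norm_power)
  finally show False using disc by simp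
qed

text \<open>
Some positive integer multiple of \<open>z\<close> lies in \<open>\<int>[\<beta>]\<close>, and
its factors \<open>p\<close> can be cancelled one after another by
\<open>no_p_denominators\<close>.
\<close>
lemma coprime_denominator:
  assumes p: "Factorial_Ring.prime (p :: nat)"
    and rs: "mset rs = proots (map_poly of_int h)" and disc: "cmod (sq_diff_prod rs) < (real p)\<^sup>2"
    and z: "z \<in> R"
  obtains m q where "\<not> p dvd m" "of_nat m * z = ev q"
proof -
  obtain n q where nq: "n > 0" "of_nat n * z = ev q"
    using z K_denominator unfolding R_def by blast
  then obtain k m where km: "n = p ^ k * m" "\<not> p dvd m"
    using multiplicity_decompose'[of n p] p by (metis not_prime_unit prime_gt_0_nat less_not_refl3)
  have "of_nat (p ^ k * m) * z = ev q \<Longrightarrow> \<exists>q. of_nat m * z = ev q" for q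
  proof (induction k arbitrary: q)
    case (Suc k)
    have "of_nat p * (of_nat (p ^ k * m) * z) = ev q"
      using Suc.prems by (simp add: mult_ac)
    moreover have "of_nat (p ^ k * m) * z \<in> R" using z by (intro R_closed)
    ultimately have "of_nat (p ^ k * m) * z \<in> range ev"
      by (intro no_p_denominators[OF p rs disc]) (auto simp: R_def)
    then show ?case using Suc.IH by blast
  qed auto
  then obtain q' where "of_nat m * z = ev q'" using nq(2) km(1) by blast
  with km(2) show ?thesis by (rule that)
qed

section \<open>Prime ideals of the ring of integers\<close>

text \<open>
Prime ideals of \<open>R\<close> in terms of complex arithmetic, which spares the record
operations of \<^term>\<open>ring_of_integers K\<close>; \<open>primeideal_iff\<close> below
shows that the two notions agree.
\<close>
definition prime_ideal :: "complex set \<Rightarrow> bool" where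
  "prime_ideal P \<longleftrightarrow> P \<subseteq> R \<and> 0 \<in> P \<and> (\<forall>x\<in>P. \<forall>y\<in>P. x + y \<in> P) \<and>
     (\<forall>x\<in>R. \<forall>y\<in>P. x * y \<in> P) \<and> 1 \<notin> P \<and>
     (\<forall>x\<in>R. \<forall>y\<in>R. x * y \<in> P \<longrightarrow> x \<in> P \<or> y \<in> P)"

text \<open>
The residue class of \<open>z\<close> modulo \<open>P\<close>, written without reference to the
ring record.
\<close>
definition coset :: "complex set \<Rightarrow> complex \<Rightarrow> complex set" where
  "coset P z = (\<lambda>h. h + z) ` P"

lemma ring_of_integers_ops:
  "carrier (ring_of_integers K) = R" "\<zero>\<^bsub>ring_of_integers K\<^esub> = 0" "\<one>\<^bsub>ring_of_integers K\<^esub> = 1"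
  "x \<oplus>\<^bsub>ring_of_integers K\<^esub> y = x + y" "x \<otimes>\<^bsub>ring_of_integers K\<^esub> y = x * y"
  by (simp_all add: ring_of_integers_def R_def ring_of_type_algebra_def)

lemma cring_of_integers: "cring (ring_of_integers K)"
proof (intro cringI abelian_groupI comm_monoidI)
  fix x assume "x \<in> carrier (ring_of_integers K)"
  then show "\<exists>y\<in>carrier (ring_of_integers K).
      y \<oplus>\<^bsub>ring_of_integers K\<^esub> x = \<zero>\<^bsub>ring_of_integers K\<^esub>"
    by (intro bexI[of _ "- x"]) (auto simp: ring_of_integers_ops R_closed)
qed (simp_all add: ring_of_integers_ops R_closed algebra_simps)

lemma primeideal_iff: "primeideal P (ring_of_integers K) \<longleftrightarrow> prime_ideal P"
proof
  assume "primeideal P (ring_of_integers K)"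
  then interpret primeideal P "ring_of_integers K" .
  have "1 \<notin> P"
    using one_imp_carrier I_notcarr by (auto simp: ring_of_integers_ops)
  then show "prime_ideal P"
    unfolding prime_ideal_def
    using a_subset additive_subgroup.zero_closed[OF additive_subgroup_axioms]
      additive_subgroup.a_closed[OF additive_subgroup_axioms] I_l_closed I_prime
    by (auto simp: ring_of_integers_ops)
next
  assume P: "prime_ideal P"
  interpret cring "ring_of_integers K" by (rule cring_of_integers)
  have minus: "\<ominus>\<^bsub>ring_of_integers K\<^esub> x = - x" if "x \<in> R" for x
    by (rule minus_equality) (use that in \<open>auto simp: ring_of_integers_ops R_closed\<close>)
  have neg: "\<ominus>\<^bsub>ring_of_integers K\<^esub> x \<in> P" if "x \<in> P" for x
  proof -
    have "(- 1) * x \<in> P" using P that R_closed unfolding prime_ideal_def by blast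
    then show ?thesis using minus that P by (auto simp: prime_ideal_def)
  qed
  have "subgroup P (add_monoid (ring_of_integers K))"
  proof (rule subgroup.intro)
    show "inv\<^bsub>add_monoid (ring_of_integers K)\<^esub> x \<in> P" if "x \<in> P" for x
      using neg[OF that] by (simp only: a_inv_def)
  qed (use P in \<open>auto simp: prime_ideal_def ring_of_integers_ops\<close>)
  moreover have "x * y \<in> P" "y * x \<in> P" if "x \<in> R" "y \<in> P" for x y
    using P that by (auto simp: prime_ideal_def mult.commute[of y])
  ultimately have "ideal P (ring_of_integers K)"
    by (intro idealI ring_axioms) (auto simp: ring_of_integers_ops)
  moreover have "R \<noteq> P" using P R_closed(2) by (auto simp: prime_ideal_def)
  ultimately show "primeideal P (ring_of_integers K)"
    using P by (intro primeidealI cring_of_integers) (auto simp: prime_ideal_def ring_of_integers_ops)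
qed

lemma ideal_norm_eq: "ideal_norm (ring_of_integers K) P = card (coset P ` R)"
proof -
  have "coset P z = P +>\<^bsub>ring_of_integers K\<^esub> z" for z
    by (auto simp: coset_def a_r_coset_def' ring_of_integers_ops)
  then have "carrier (ring_of_integers K Quot P) = coset P ` R"
    by (auto simp: FactRing_def A_RCOSETS_def' a_r_coset_def' ring_of_integers_ops coset_def)
  then show ?thesis by (simp add: ideal_norm_def)
qed

context
  fixes P assumes P: "prime_ideal P"
begin

lemma ideal_closed:
  shows "x \<in> P \<Longrightarrow> x \<in> R" "0 \<in> P" "x \<in> P \<Longrightarrow> y \<in> P \<Longrightarrow> x + y \<in> P"
    "x \<in> R \<Longrightarrow> y \<in> P \<Longrightarrow> x * y \<in> P" "x \<in> P \<Longrightarrow> y \<in> R \<Longrightarrow> x * y \<in> P"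
    "1 \<notin> P" "x \<in> R \<Longrightarrow> y \<in> R \<Longrightarrow> x * y \<in> P \<Longrightarrow> x \<in> P \<or> y \<in> P"
  using P unfolding prime_ideal_def by (auto simp: mult.commute)

lemma ideal_minus: "x \<in> P \<Longrightarrow> - x \<in> P"
  using ideal_closed(4)[of "- 1" x] R_closed(6)[of 1] R_closed(2) by simp

lemma ideal_diff: "x \<in> P \<Longrightarrow> y \<in> P \<Longrightarrow> x - y \<in> P"
  using ideal_closed(3)[of x "- y"] ideal_minus by simp

lemma ideal_sum: "(\<And>i. i \<in> I \<Longrightarrow> f i \<in> P) \<Longrightarrow> sum f I \<in> P"
  by (induction I rule: infinite_finite_induct) (auto simp: ideal_closed)

lemma coset_eq_iff: "coset P z = coset P z' \<longleftrightarrow> z - z' \<in> P"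
proof
  assume "coset P z = coset P z'"
  moreover have "z \<in> coset P z"
    using ideal_closed(2) unfolding coset_def by (metis add_0 imageI)
  ultimately show "z - z' \<in> P" by (auto simp: coset_def)
next
  have *: "coset P x \<subseteq> coset P y" if "x - y \<in> P" for x y
  proof
    fix w assume "w \<in> coset P x"
    then obtain t where "t \<in> P" "w = t + x" by (auto simp: coset_def)
    then have "w = (t + (x - y)) + y" "t + (x - y) \<in> P"
      using that ideal_closed(3) by auto
    then show "w \<in> coset P y" unfolding coset_def by blast
  qed
  assume "z - z' \<in> P"
  then show "coset P z = coset P z'"
    using *[of z z'] *[of z' z] ideal_minus[of "z - z'"] by simp
qed

text \<open>
The lowest nonzero coefficient of \<open>M\<close> is a multiple of \<open>z\<close> in
\<open>R\<close>.
\<close>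
lemma ideal_contains_integer:
  assumes z: "z \<in> P" "z \<noteq> 0" and M: "M \<noteq> 0" "poly (map_poly of_int M) z = 0"
  shows "\<exists>n. n \<noteq> 0 \<and> of_int n \<in> P"
  using M
proof (induction M)
  case (pCons a M)
  have eq: "of_int a + z * poly (map_poly of_int M) z = 0"
    using pCons.prems by (simp add: map_pCons_simps)
  show ?case
  proof (cases "a = 0")
    case False
    have "z * poly (map_poly of_int M) z \<in> P"
      using z by (intro ideal_closed(5) poly_in_R ideal_closed(1))
    then have "of_int a \<in> P"
      using eq ideal_minus by (metis add_eq_0_iff2)
    then show ?thesis using False by blast
  next
    case True
    then have "M \<noteq> 0" "poly (map_poly of_int M) z = 0" using pCons.prems eq z(2) by auto
    then show ?thesis by (rule pCons.IH)
  qed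
qed simp

lemma ideal_contains_prime:
  assumes "P \<noteq> {0}"
  obtains p where "Factorial_Ring.prime (p :: nat)" "of_nat p \<in> P"
proof -
  obtain z where z: "z \<in> P" "z \<noteq> 0" using assms ideal_closed(2) by blast
  then have "algebraic_int z" using ideal_closed(1) by (auto simp: R_def)
  then obtain M :: "int poly" where M: "poly (map_poly of_int M) z = 0" "Polynomial.lead_coeff M = 1"
    unfolding algebraic_int_altdef_ipoly by blast
  then have "M \<noteq> 0" by auto
  then obtain n where n: "n \<noteq> 0" "of_int n \<in> P"
    using ideal_contains_integer z M by blast
  have "of_nat (nat \<bar>n\<bar>) \<in> P"
    using n ideal_minus[of "of_int n"] by (cases "n \<ge> 0") simp_all
  then have ex: "\<exists>m. m > 0 \<and> of_nat m \<in> P" using n(1) by (intro exI[of _ "nat \<bar>n\<bar>"]) auto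
  \<comment> \<open>The least positive integer in a prime ideal is a prime number.\<close>
  define p where "p = (LEAST m. m > 0 \<and> of_nat m \<in> P)"
  have p: "p > 0" "of_nat p \<in> P" using LeastI_ex[OF ex] by (auto simp: p_def)
  have least: "p \<le> m" if "m > 0" "of_nat m \<in> P" for m
    unfolding p_def using that by (intro Least_le) auto
  have "p \<noteq> 1" using p(2) ideal_closed(6) by auto
  moreover have "a = 1 \<or> b = 1" if ab: "p = a * b" for a b
  proof -
    have "of_nat a * of_nat b \<in> P" using p(2) ab by simp
    then have "of_nat a \<in> P \<or> of_nat b \<in> P" by (intro ideal_closed(7) R_closed)
    moreover have "a > 0" "b > 0" using p(1) ab by auto
    ultimately show ?thesis using least[of a] least[of b] ab by auto
  qed
  ultimately have "Factorial_Ring.prime p" using p(1)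
    by (simp add: prime_nat_iff) (metis dvdE mult.right_neutral mult_1)
  then show ?thesis using that p(2) by blast
qed

context
  fixes p :: nat assumes p: "Factorial_Ring.prime p" "of_nat p \<in> P"
begin

lemma of_int_in_ideal_iff: "of_int n \<in> P \<longleftrightarrow> int p dvd n"
proof
  assume "int p dvd n"
  then obtain k where "n = int p * k" by (metis dvdE)
  then show "of_int n \<in> P" using p(2) by (simp add: ideal_closed R_closed)
next
  assume n: "of_int n \<in> P"
  show "int p dvd n"
  proof (rule ccontr)
    assume "\<not> int p dvd n"
    then obtain u t where "u * n = 1 + int p * t" by (rule inverse_mod_prime[OF p(1)])
    then have "of_int u * of_int n = 1 + of_nat p * (of_int t :: complex)"
      by (metis of_int_1 of_int_add of_int_mult of_int_of_nat_eq)
    then have "1 = of_int u * of_int n - of_nat p * (of_int t :: complex)" by simp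
    moreover have "\<dots> \<in> P"
      by (intro ideal_diff ideal_closed(4)[OF _ n] ideal_closed(5)[OF p(2)] R_closed(3))
    ultimately show False using ideal_closed(6) by simp
  qed
qed

lemma p_mult_in_ideal: "int p dvd n \<Longrightarrow> z \<in> R \<Longrightarrow> of_int n * z \<in> P"
  by (intro ideal_closed(5)) (simp_all add: of_int_in_ideal_iff)

text \<open>
A family in \<open>R\<close> that is independent modulo \<open>P\<close> over the field with
\<open>p\<close> elements admits no integer relation unless all coefficients are divisible by
\<open>p\<close>, so by \<open>integer_relation\<close> it has at most \<open>d\<close> members.
The elements of a largest such family generate \<open>R\<close> modulo \<open>P\<close>, and
coefficients between \<open>0\<close> and \<open>p - 1\<close> are enough.
\<close>
lemma finite_quotient: "finite (coset P ` R)"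
proof -
  define indep where "indep = (\<lambda>S. finite S \<and> S \<subseteq> R \<and>
    (\<forall>a. (\<Sum>s\<in>S. of_int (a s) * s) \<in> P \<longrightarrow> (\<forall>s\<in>S. int p dvd a s)))"
  have card_le: "card S < Suc d" if S: "indep S" for S
  proof (rule ccontr)
    assume "\<not> card S < Suc d"
    then obtain a where "(\<Sum>s\<in>S. of_int (a s) * s) = 0" "\<exists>s\<in>S. \<not> int p dvd a s"
      using integer_relation[of S "int p"] S p(1) by (auto simp: indep_def R_def subset_iff)
    then show False using S ideal_closed(2) by (auto simp: indep_def)
  qed
  have "indep {}" by (simp add: indep_def)
  then obtain S where S: "indep S" and max: "\<And>T. indep T \<Longrightarrow> card T \<le> card S"
    using ex_has_greatest_nat[of indep "{}" card "Suc d"] card_le by blast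
  have fS: "finite S" "S \<subseteq> R" using S by (auto simp: indep_def)
  \<comment> \<open>Adjoining \<open>z\<close> to a largest independent family gives a relation in which the coefficient of \<open>z\<close>
    is prime to \<open>p\<close> and can be inverted modulo \<open>p\<close>.\<close>
  have span: "\<exists>a. z - (\<Sum>s\<in>S. of_int (a s) * s) \<in> P" if z: "z \<in> R" for z
  proof (cases "z \<in> S")
    case True
    have "(\<Sum>s\<in>S. of_int (if s = z then 1 else 0) * s) = z"
      using fS True by (simp add: if_distrib[of of_int] if_distrib[of "\<lambda>x. x * _"] cong: if_cong)
    then show ?thesis using ideal_closed(2)
      by (intro exI[of _ "\<lambda>s. if s = z then 1 else 0"]) simp
  next
    case False
    have "\<not> indep (insert z S)"
      using max[of "insert z S"] False fS by auto
    then obtain a where a: "(\<Sum>s\<in>insert z S. of_int (a s) * s) \<in> P" "\<exists>s\<in>insert z S. \<not> int p dvd a s"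
      using fS z unfolding indep_def by blast
    then have sum: "of_int (a z) * z + (\<Sum>s\<in>S. of_int (a s) * s) \<in> P" using fS False by simp
    have az: "\<not> int p dvd a z"
    proof
      assume az: "int p dvd a z"
      then have "of_int (a z) * z \<in> P" using z by (rule p_mult_in_ideal)
      with sum have "(\<Sum>s\<in>S. of_int (a s) * s) \<in> P"
        using ideal_diff by (metis add_diff_cancel_left')
      then show False using S a(2) az by (auto simp: indep_def)
    qed
    obtain u t where ut: "u * a z = 1 + int p * t" by (rule inverse_mod_prime[OF p(1) az])
    have "z - (\<Sum>s\<in>S. of_int (- u * a s) * s) =
        of_int (u * a z) * z + of_int u * (\<Sum>s\<in>S. of_int (a s) * s) - of_int (int p * t) * z"
      by (simp add: ut algebra_simps sum_distrib_left sum_negf)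
    also have "\<dots> = of_int u * (of_int (a z) * z + (\<Sum>s\<in>S. of_int (a s) * s)) - of_int (int p * t) * z"
      by (simp add: algebra_simps)
    also have "\<dots> \<in> P"
      by (intro ideal_diff ideal_closed(4) sum p_mult_in_ideal z R_closed) auto
    finally show ?thesis by (intro exI[of _ "\<lambda>s. - u * a s"])
  qed
  have "coset P ` R \<subseteq> (\<lambda>a. coset P (\<Sum>s\<in>S. of_int (a s) * s)) ` (PiE S (\<lambda>_. {0..<int p}))"
  proof
    fix C assume "C \<in> coset P ` R"
    then obtain z where z: "z \<in> R" "C = coset P z" by blast
    obtain a where a: "z - (\<Sum>s\<in>S. of_int (a s) * s) \<in> P" using span[OF z(1)] by blast
    define b where "b = restrict (\<lambda>s. a s mod int p) S"
    have "(\<Sum>s\<in>S. of_int (a s) * s) - (\<Sum>s\<in>S. of_int (b s) * s) = (\<Sum>s\<in>S. of_int (a s - a s mod int p) * s)"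
      by (simp add: b_def algebra_simps sum_subtractf)
    also have "\<dots> \<in> P"
      using fS by (intro ideal_sum p_mult_in_ideal) auto
    finally have "(z - (\<Sum>s\<in>S. of_int (a s) * s)) +
        ((\<Sum>s\<in>S. of_int (a s) * s) - (\<Sum>s\<in>S. of_int (b s) * s)) \<in> P"
      by (rule ideal_closed(3)[OF a])
    then have "z - (\<Sum>s\<in>S. of_int (b s) * s) \<in> P" by simp
    then have "C = coset P (\<Sum>s\<in>S. of_int (b s) * s)" using z coset_eq_iff by simp
    moreover have "b \<in> PiE S (\<lambda>_. {0..<int p})"
      using p(1) prime_gt_0_nat[of p] by (auto simp: b_def)
    ultimately show "C \<in> (\<lambda>a. coset P (\<Sum>s\<in>S. of_int (a s) * s)) ` (PiE S (\<lambda>_. {0..<int p}))"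
      by blast
  qed
  then show ?thesis
    by (rule finite_subset) (intro finite_imageI finite_PiE fS; simp)
qed

lemma inj_coset_of_int: "inj_on (\<lambda>a. coset P (of_int a)) {0..<int p}"
proof (rule inj_onI)
  fix a b assume ab: "a \<in> {0..<int p}" "b \<in> {0..<int p}" "coset P (of_int a) = coset P (of_int b)"
  then have "of_int (a - b) \<in> P" by (simp add: coset_eq_iff)
  then show "a = b" using ab residue_eqI by (simp only: of_int_in_ideal_iff)
qed

lemma norm_eq_p_imp_residue:
  assumes "card (coset P ` R) = p" "z \<in> R"
  shows "\<exists>a\<in>{0..<int p}. z - of_int a \<in> P"
proof -
  have sub: "(\<lambda>a. coset P (of_int a)) ` {0..<int p} \<subseteq> coset P ` R"
    by (intro image_subsetI imageI R_closed(3))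
  have "card ((\<lambda>a. coset P (of_int a)) ` {0..<int p}) = p"
    using card_image[OF inj_coset_of_int] by simp
  then have "(\<lambda>a. coset P (of_int a)) ` {0..<int p} = coset P ` R"
    using assms(1) by (intro card_subset_eq finite_quotient sub) simp
  then have "coset P z \<in> (\<lambda>a. coset P (of_int a)) ` {0..<int p}" using assms(2) by auto
  then show ?thesis by (auto simp: coset_eq_iff)
qed

lemma residue_of_int:
  assumes "z - of_int n \<in> P"
  shows "\<exists>a\<in>{0..<int p}. z - of_int a \<in> P"
proof
  have "of_int (n - n mod int p) \<in> P"
    unfolding of_int_in_ideal_iff by simp
  with assms have "(z - of_int n) + of_int (n - n mod int p) \<in> P" by (rule ideal_closed(3))
  then show "z - of_int (n mod int p) \<in> P" by simp
  show "n mod int p \<in> {0..<int p}" using prime_gt_0_nat[OF p(1)] by simp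
qed

lemma norm_eq_p_if_residues:
  assumes "\<And>z. z \<in> R \<Longrightarrow> \<exists>n. z - of_int n \<in> P"
  shows "card (coset P ` R) = p"
proof -
  have "\<forall>z\<in>R. \<exists>a\<in>{0..<int p}. z - of_int a \<in> P" using assms residue_of_int by blast
  then have "coset P ` R \<subseteq> (\<lambda>a. coset P (of_int a)) ` {0..<int p}"
    by (metis (no_types, lifting) coset_eq_iff image_subset_iff image_eqI)
  moreover have "(\<lambda>a. coset P (of_int a)) ` {0..<int p} \<subseteq> coset P ` R"
    by (intro image_subsetI imageI R_closed(3))
  ultimately have "coset P ` R = (\<lambda>a. coset P (of_int a)) ` {0..<int p}" by (rule equalityI)
  then show ?thesis using card_image[OF inj_coset_of_int] by simp
qed

text \<open>
Either the integers \<open>0, \<dots>, p - 1\<close> represent all residue classes, or there is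
a residue class \<open>y\<close> that contains no integer, and then the \<open>p\<^sup>2\<close>
elements \<open>a + b y\<close> with \<open>0 \<le> a, b < p\<close> are incongruent modulo
\<open>P\<close>.
\<close>
lemma norm_p_or_ge_p2: "card (coset P ` R) = p \<or> card (coset P ` R) \<ge> p\<^sup>2"
proof (cases "\<forall>z\<in>R. \<exists>n. z - of_int n \<in> P")
  case True
  then show ?thesis using norm_eq_p_if_residues by blast
next
  case False
  then obtain y where y: "y \<in> R" "\<And>n. y - of_int n \<notin> P" by blast
  let ?f = "\<lambda>(a, b). coset P (of_int a + of_int b * y)"
  have "inj_on ?f ({0..<int p} \<times> {0..<int p})"
  proof (rule inj_onI, clarify)
    fix a b a' b'
    assume ab: "a \<in> {0..<int p}" "b \<in> {0..<int p}" "a' \<in> {0..<int p}" "b' \<in> {0..<int p}"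
      and eq: "coset P (of_int a + of_int b * y) = coset P (of_int a' + of_int b' * y)"
    have D: "of_int (a - a') + of_int (b - b') * y \<in> P"
      using eq unfolding coset_eq_iff by (simp add: algebra_simps)
    have b: "b = b'"
    proof (rule ccontr)
      assume "b \<noteq> b'"
      then have "\<not> int p dvd b - b'" using ab residue_eqI by blast
      then obtain u t where ut: "u * (b - b') = 1 + int p * t" by (rule inverse_mod_prime[OF p(1)])
      have "of_int u * (of_int (a - a') + of_int (b - b') * y) - of_int (int p * t) * y \<in> P"
        by (intro ideal_diff ideal_closed(4) D p_mult_in_ideal y R_closed) auto
      also have "of_int u * (of_int (a - a') + of_int (b - b') * y) - of_int (int p * t) * y =
          of_int (u * (a - a')) + of_int (u * (b - b') - int p * t) * y"
        by (simp add: algebra_simps)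
      also have "\<dots> = y - of_int (- (u * (a - a')))" by (simp add: ut)
      finally show False using y(2) by blast
    qed
    with D have "of_int (a - a') \<in> P" by simp
    then have "a = a'" using ab residue_eqI by (simp only: of_int_in_ideal_iff)
    with b show "a = a' \<and> b = b'" by simp
  qed
  moreover have "?f ` ({0..<int p} \<times> {0..<int p}) \<subseteq> coset P ` R"
  proof clarify
    fix a b
    show "coset P (of_int a + of_int b * y) \<in> coset P ` R"
      by (intro imageI R_closed(5) R_closed(7) R_closed(3) y(1))
  qed
  ultimately have "card ({0..<int p} \<times> {0..<int p}) \<le> card (coset P ` R)"
    using finite_quotient by (rule card_inj_on_le)
  then show ?thesis by (simp add: power2_eq_square)
qed

end

end

definition primes_above :: "nat \<Rightarrow> complex set set" where
  "primes_above p = {P. prime_ideal P \<and> of_nat p \<in> P}"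

text \<open>
The residue ring of \<open>P\<close> is finite, so an element \<open>y\<close> outside
\<open>P\<close> has a power \<open>y ^ Suc k\<close> congruent to \<open>1\<close> modulo
\<open>P\<close>. If \<open>y\<close> lay in a larger prime ideal \<open>Q\<close>, then
\<open>Q\<close> would contain \<open>1\<close>.
\<close>
lemma primes_above_incomparable:
  assumes p: "Factorial_Ring.prime p" and PQ: "P \<in> primes_above p" "Q \<in> primes_above p" "P \<subseteq> Q"
  shows "P = Q"
proof (rule ccontr)
  assume "P \<noteq> Q"
  then obtain y where y: "y \<in> Q" "y \<notin> P" using PQ by blast
  have P: "prime_ideal P" "of_nat p \<in> P" and Q: "prime_ideal Q" using PQ by (auto simp: primes_above_def)
  have yR: "y \<in> R" using ideal_closed(1)[OF Q] y by blast
  have "\<not> inj (\<lambda>n. coset P (y ^ n))"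
  proof
    assume "inj (\<lambda>n. coset P (y ^ n))"
    moreover have "range (\<lambda>n. coset P (y ^ n)) \<subseteq> coset P ` R" using R_power[OF yR] by auto
    ultimately show False
      using finite_quotient[OF P(1) p P(2)] by (meson finite_subset infinite_UNIV_nat inj_on_finite top_greatest)
  qed
  then obtain m n where mn: "m < n" "coset P (y ^ n) = coset P (y ^ m)"
    by (metis (mono_tags, lifting) injI nat_neq_iff)
  then obtain k where k: "n = m + Suc k" using less_iff_Suc_add by auto
  have "y ^ m * (y ^ Suc k - 1) \<in> P"
    using mn(2) by (simp add: coset_eq_iff[OF P(1)] k power_add algebra_simps)
  moreover have "y ^ m \<notin> P" for m
  proof (induction m)
    case (Suc m)
    then show ?case using ideal_closed(7)[OF P(1) yR R_power[OF yR], of m] y(2) by auto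
  qed (use ideal_closed(6)[OF P(1)] in simp)
  moreover have "y ^ Suc k - 1 \<in> R"
    by (intro R_closed(8) R_power yR R_closed(2))
  ultimately have "y ^ Suc k - 1 \<in> P"
    using ideal_closed(7)[OF P(1) R_power[OF yR]] by blast
  then have "y ^ Suc k - 1 \<in> Q" using PQ by blast
  moreover have "y ^ Suc k \<in> Q"
    using ideal_closed(5)[OF Q y(1) R_power[OF yR, of k]] by simp
  ultimately have "y ^ Suc k - (y ^ Suc k - 1) \<in> Q" using ideal_diff[OF Q] by blast
  then show False using ideal_closed(6)[OF Q] by simp
qed

text \<open>
Since \<open>Q\<close> is not contained in \<open>P\<close>, there is an element of
\<open>Q\<close> outside \<open>P\<close>; the product of these elements over all \<open>Q
\<noteq> P\<close> in \<open>T\<close> stays outside the prime ideal \<open>P\<close>.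
\<close>
lemma separating_element:
  assumes p: "Factorial_Ring.prime p" and T: "finite T" "T \<subseteq> primes_above p" and P: "P \<in> T"
  shows "\<exists>e\<in>R. e \<notin> P \<and> (\<forall>Q\<in>T - {P}. e \<in> Q)"
proof -
  have PP: "prime_ideal P" using T P by (auto simp: primes_above_def)
  have "\<exists>z\<in>R. z \<in> Q \<and> z \<notin> P" if "Q \<in> T - {P}" for Q
  proof -
    have "prime_ideal Q" using that T by (auto simp: primes_above_def)
    moreover have "\<not> Q \<subseteq> P" using primes_above_incomparable[OF p, of Q P] that T P by blast
    ultimately show ?thesis using ideal_closed(1) by blast
  qed
  then obtain z where z: "\<And>Q. Q \<in> T - {P} \<Longrightarrow> z Q \<in> R \<and> z Q \<in> Q \<and> z Q \<notin> P" by metis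
  have fin: "finite U \<Longrightarrow> U \<subseteq> T - {P} \<Longrightarrow> prod z U \<in> R \<and> prod z U \<notin> P \<and> (\<forall>Q\<in>U. prod z U \<in> Q)" for U
  proof (induction U rule: finite_induct)
    case empty
    then show ?case using ideal_closed(6)[OF PP] R_closed by simp
  next
    case (insert Q U)
    have IH: "prod z U \<in> R" "prod z U \<notin> P" "\<And>Q. Q \<in> U \<Longrightarrow> prod z U \<in> Q" using insert by auto
    have zQ: "z Q \<in> R" "z Q \<in> Q" "z Q \<notin> P" using z[of Q] insert by auto
    have prod: "prod z (insert Q U) = z Q * prod z U" using insert.hyps by simp
    have "z Q * prod z U \<in> Q'" if "Q' \<in> insert Q U" for Q'
    proof -
      have Q': "prime_ideal Q'" using that insert.prems T by (auto simp: primes_above_def)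
      show ?thesis
      proof (cases "Q' = Q")
        case True
        then show ?thesis using ideal_closed(5)[OF Q'] zQ(2) IH(1) by blast
      next
        case False
        then show ?thesis using ideal_closed(4)[OF Q'] zQ(1) IH(3) that by blast
      qed
    qed
    then show ?case unfolding prod
      using ideal_closed(7)[OF PP zQ(1) IH(1)] zQ(3) IH(1,2) R_closed(7)[OF zQ(1) IH(1)] by blast
  qed
  have "finite (T - {P})" using T by simp
  from fin[OF this subset_refl] show ?thesis by blast
qed

text \<open>
Choose for each \<open>P\<close> an element \<open>e P\<close> that lies in all the other primes
but not in \<open>P\<close>. Reducing an integer relation between these elements modulo
\<open>P\<close> leaves only the term of \<open>e P\<close>, so \<open>p\<close> divides its
coefficient. Hence there are at most \<open>d\<close> such elements.
\<close>
lemma card_primes_above: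
  assumes p: "Factorial_Ring.prime p"
  shows "finite (primes_above p) \<and> card (primes_above p) \<le> d"
proof (rule finite_if_finite_subsets_card_bdd)
  fix T assume T: "T \<subseteq> primes_above p" "finite T"
  have "\<forall>P\<in>T. \<exists>e\<in>R. e \<notin> P \<and> (\<forall>Q\<in>T - {P}. e \<in> Q)"
    using separating_element[OF p T(2,1)] by blast
  then obtain e where e: "\<And>P. P \<in> T \<Longrightarrow> e P \<in> R \<and> e P \<notin> P"
      "\<And>P Q. P \<in> T \<Longrightarrow> Q \<in> T \<Longrightarrow> Q \<noteq> P \<Longrightarrow> e P \<in> Q"
    by (metis Diff_iff singletonD)
  have inj: "inj_on e T" using e by (metis inj_onI)
  show "card T \<le> d"
  proof (rule ccontr)
    assume "\<not> card T \<le> d"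
    then have card: "card (e ` T) > d" using card_image[OF inj] by simp
    have sub: "e ` T \<subseteq> K" using e(1) by (auto simp: R_def)
    have fin: "finite (e ` T)" and p': "Factorial_Ring.prime (int p)" using T(2) p by auto
    obtain a where a: "(\<Sum>s\<in>e ` T. of_int (a s) * s) = 0" "\<exists>s\<in>e ` T. \<not> int p dvd a s"
      by (rule integer_relation[OF fin sub card p'])
    then obtain P where P: "P \<in> T" "\<not> int p dvd a (e P)" by auto
    have PP: "prime_ideal P" "of_nat p \<in> P" using T P by (auto simp: primes_above_def)
    have "0 = (\<Sum>Q\<in>T. of_int (a (e Q)) * e Q)" using a(1) inj by (simp add: sum.reindex)
    also have "\<dots> = of_int (a (e P)) * e P + (\<Sum>Q\<in>T - {P}. of_int (a (e Q)) * e Q)"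
      using T P by (simp add: sum.remove)
    finally have "of_int (a (e P)) * e P = - (\<Sum>Q\<in>T - {P}. of_int (a (e Q)) * e Q)"
      by (simp add: eq_neg_iff_add_eq_0)
    also have "\<dots> \<in> P"
      using e P by (intro ideal_minus[OF PP(1)] ideal_sum[OF PP(1)] ideal_closed(4)[OF PP(1)] R_closed) blast
    finally have "of_int (a (e P)) \<in> P"
      using ideal_closed(7)[OF PP(1)] R_closed(3) e(1) P(1) by blast
    then show False using of_int_in_ideal_iff[OF PP(1) p PP(2)] P(2) by simp
  qed
qed

section \<open>Primes of degree one and roots modulo a prime\<close>

lemma ev_cong_ideal:
  assumes P: "prime_ideal P" and b: "\<beta> - of_int b \<in> P"
  shows "ev q - of_int (poly q b) \<in> P"
proof (induction q)
  case (pCons a q)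
  have "ev (pCons a q) - of_int (poly (pCons a q) b) =
      \<beta> * (ev q - of_int (poly q b)) + of_int (poly q b) * (\<beta> - of_int b)"
    by (simp add: map_pCons_simps algebra_simps)
  also have "\<dots> \<in> P"
    by (intro ideal_closed(3,4)[OF P] pCons.IH b beta_in_R R_closed(3))
  finally show ?case .
qed (simp add: ideal_closed(2)[OF P])

context
  fixes p :: nat
  assumes p: "Factorial_Ring.prime p"
    and denominator: "\<And>z. z \<in> R \<Longrightarrow> \<exists>m q. \<not> p dvd m \<and> of_nat m * z = ev q"
begin

text \<open>
For a root \<open>b\<close> of \<open>h\<close> modulo \<open>p\<close>, this is the kernel of
the ring homomorphism from \<open>R\<close> to the field with \<open>p\<close> elements that
sends \<open>\<beta>\<close> to \<open>b\<close>. An element \<open>z\<close> with \<open>m z =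
ev q\<close> is sent to \<open>q b / m\<close>, which makes sense as \<open>p\<close> does not
divide \<open>m\<close>.
\<close>
definition residue_ideal :: "int \<Rightarrow> complex set" where
  "residue_ideal b = {z \<in> R. \<exists>m q. \<not> p dvd m \<and> of_nat m * z = ev q \<and> int p dvd poly q b}"

lemma residue_idealI:
  "z \<in> R \<Longrightarrow> \<not> p dvd m \<Longrightarrow> of_nat m * z = ev q \<Longrightarrow> int p dvd poly q b \<Longrightarrow> z \<in> residue_ideal b"
  by (auto simp: residue_ideal_def)

lemma prime_dvd_times_nat: "int p dvd int m * n \<longleftrightarrow> p dvd m \<or> int p dvd n"
  using p by (simp add: prime_dvd_mult_iff)

context
  fixes b :: int assumes b: "int p dvd poly h b"
begin

text \<open>
Membership does not depend on the chosen fraction: two representations of \<open>z\<close> give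
equal elements of \<open>\<int>[\<beta>]\<close> after cross multiplication, and these have
congruent values at the root \<open>b\<close> modulo \<open>p\<close>.
\<close>
lemma residue_idealD:
  assumes z: "z \<in> residue_ideal b" and m: "of_nat m * z = ev q"
  shows "int p dvd poly q b"
proof -
  obtain m' q' where m': "\<not> p dvd m'" "of_nat m' * z = ev q'" "int p dvd poly q' b"
    using z by (auto simp: residue_ideal_def)
  have "ev (Polynomial.smult (int m') q) = ev (Polynomial.smult (int m) q')"
    unfolding ev_algebra using m m'(2) by (metis mult.left_commute of_int_of_nat_eq)
  then have "int p dvd int m' * poly q b - int m * poly q' b"
    using ev_cong_roots[OF _ b] by fastforce
  then have "int p dvd int m' * poly q b"
    using m'(3) by (metis dvd_diffD dvd_mult dvd_diff_commute dvd_add_right_iff diff_add_cancel)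
  then show ?thesis using m'(1) prime_dvd_times_nat by simp
qed

lemma prime_residue_ideal: "prime_ideal (residue_ideal b)"
  unfolding prime_ideal_def
proof (intro conjI ballI impI)
  show "residue_ideal b \<subseteq> R" by (auto simp: residue_ideal_def)
  show "0 \<in> residue_ideal b"
    by (rule residue_idealI[of _ 1 0]) (use p R_closed(1) in auto)
next
  fix x y assume "x \<in> residue_ideal b" "y \<in> residue_ideal b"
  then obtain m q n r where x: "x \<in> R" "\<not> p dvd m" "of_nat m * x = ev q" "int p dvd poly q b"
    and y: "y \<in> R" "\<not> p dvd n" "of_nat n * y = ev r" "int p dvd poly r b"
    by (auto simp: residue_ideal_def)
  show "x + y \<in> residue_ideal b"
  proof (rule residue_idealI)
    show "x + y \<in> R" using x y by (intro R_closed)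
    show "\<not> p dvd m * n" using x y p by (simp add: prime_dvd_mult_iff)
    show "of_nat (m * n) * (x + y) = ev (Polynomial.smult (int n) q + Polynomial.smult (int m) r)"
      unfolding ev_algebra x(3)[symmetric] y(3)[symmetric] by (simp add: algebra_simps)
    show "int p dvd poly (Polynomial.smult (int n) q + Polynomial.smult (int m) r) b"
      using x(4) y(4) by simp
  qed
next
  fix x y assume xy: "x \<in> R" "y \<in> residue_ideal b"
  then obtain n r where y: "y \<in> R" "\<not> p dvd n" "of_nat n * y = ev r" "int p dvd poly r b"
    by (auto simp: residue_ideal_def)
  obtain m q where x: "\<not> p dvd m" "of_nat m * x = ev q" using denominator xy(1) by blast
  show "x * y \<in> residue_ideal b"
  proof (rule residue_idealI)
    show "x * y \<in> R" using xy y by (intro R_closed)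
    show "\<not> p dvd m * n" using x y p by (simp add: prime_dvd_mult_iff)
    show "of_nat (m * n) * (x * y) = ev (q * r)"
      unfolding ev_algebra x(2)[symmetric] y(3)[symmetric] by (simp add: algebra_simps)
    show "int p dvd poly (q * r) b" using y(4) by simp
  qed
next
  show "1 \<notin> residue_ideal b"
    using residue_idealD[of 1 1 1] p by (auto simp: ev_algebra)
next
  fix x y assume xy: "x \<in> R" "y \<in> R" "x * y \<in> residue_ideal b"
  obtain m q where x: "\<not> p dvd m" "of_nat m * x = ev q" using denominator xy(1) by blast
  obtain n r where y: "\<not> p dvd n" "of_nat n * y = ev r" using denominator xy(2) by blast
  have "of_nat (m * n) * (x * y) = ev (q * r)"
    unfolding ev_algebra x(2)[symmetric] y(2)[symmetric] by (simp add: algebra_simps)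
  from residue_idealD[OF xy(3) this] have "int p dvd poly q b \<or> int p dvd poly r b"
    using p by (simp add: prime_dvd_mult_iff)
  then show "x \<in> residue_ideal b \<or> y \<in> residue_ideal b"
    using residue_idealI x y xy(1,2) by blast
qed

lemma p_in_residue_ideal: "of_nat p \<in> residue_ideal b"
  by (rule residue_idealI[of _ 1 "[:int p:]"]) (use p R_closed(4) in \<open>auto simp: ev_algebra\<close>)

lemma beta_minus_in_residue_ideal: "\<beta> - of_int b \<in> residue_ideal b"
proof (rule residue_idealI[of _ 1 "[:- b, 1:]"])
  show "\<beta> - of_int b \<in> R" by (intro R_closed(8) beta_in_R R_closed(3))
qed (use p in \<open>auto simp: map_pCons_simps\<close>)

text \<open>
If \<open>m z = ev q\<close> and \<open>u\<close> is an inverse of \<open>m\<close> modulo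
\<open>p\<close>, then \<open>z\<close> is congruent to the integer \<open>u\<close> times the
value of \<open>q\<close> at \<open>b\<close>.
\<close>
lemma residue_ideal_norm: "card (coset (residue_ideal b) ` R) = p"
proof (rule norm_eq_p_if_residues[OF prime_residue_ideal p p_in_residue_ideal])
  fix z assume z: "z \<in> R"
  obtain m q where m: "\<not> p dvd m" "of_nat m * z = ev q" using denominator z by blast
  then have "\<not> int p dvd int m" by simp
  then obtain u t where ut: "u * int m = 1 + int p * t"
    by (rule inverse_mod_prime[OF p])
  have "z - of_int (u * poly q b) \<in> residue_ideal b"
  proof (rule residue_idealI)
    show "z - of_int (u * poly q b) \<in> R" using z by (intro R_closed(8) R_closed(3))
    show "of_nat m * (z - of_int (u * poly q b)) = ev (q - [:int m * (u * poly q b):])"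
      unfolding ev_algebra m(2)[symmetric] by (simp add: algebra_simps)
    have "poly (q - [:int m * (u * poly q b):]) b = poly q b - (u * int m) * poly q b"
      by (simp add: algebra_simps)
    also have "\<dots> = int p * (- t * poly q b)" by (simp only: ut) (simp add: algebra_simps)
    finally show "int p dvd poly (q - [:int m * (u * poly q b):]) b" by simp
  qed (rule m)
  then show "\<exists>n. z - of_int n \<in> residue_ideal b" by blast
qed

end

text \<open>
Modulo \<open>P\<close> the element \<open>\<beta>\<close> is the integer \<open>b\<close>, so
\<open>ev q\<close> lies in \<open>P\<close> if and only if \<open>p\<close> divides the value
of \<open>q\<close> at \<open>b\<close>. Clearing a denominator prime to \<open>p\<close>
extends this from \<open>\<int>[\<beta>]\<close> to \<open>R\<close>.
\<close>
lemma degree_one_prime_is_residue_ideal: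
  assumes P: "P \<in> primes_above p" and b: "\<beta> - of_int b \<in> P"
  shows "int p dvd poly h b" "P = residue_ideal b"
proof -
  have PP: "prime_ideal P" "of_nat p \<in> P" using P by (auto simp: primes_above_def)
  note in_P = of_int_in_ideal_iff[OF PP(1) p PP(2)]
  note cong = ev_cong_ideal[OF PP(1) b]
  have "of_int (poly h b) \<in> P"
    using ideal_minus[OF PP(1) cong[of h]] root by simp
  then show "int p dvd poly h b" using in_P by blast
  have iff: "z \<in> P \<longleftrightarrow> int p dvd poly q b"
    if z: "z \<in> R" and m: "\<not> p dvd m" "of_nat m * z = ev q" for z m q
  proof -
    have "of_int (int m) \<notin> P" using m(1) unfolding in_P by simp
    then have "z \<in> P \<longleftrightarrow> ev q \<in> P"
      using ideal_closed(4,7)[OF PP(1)] z R_closed(4)[of m] m(2) by (metis of_int_of_nat_eq)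
    also have "\<dots> \<longleftrightarrow> of_int (poly q b) \<in> P"
      using ideal_diff[OF PP(1) _ cong[of q], of "ev q"]
        ideal_closed(3)[OF PP(1) _ cong[of q], of "of_int (poly q b)"] by auto
    finally show ?thesis by (simp only: in_P)
  qed
  show "P = residue_ideal b"
  proof (rule equalityI; rule subsetI)
    fix z assume z: "z \<in> P"
    then have "z \<in> R" by (rule ideal_closed(1)[OF PP(1)])
    moreover obtain m q where "\<not> p dvd m" "of_nat m * z = ev q"
      using denominator[OF \<open>z \<in> R\<close>] by blast
    ultimately show "z \<in> residue_ideal b" using iff z residue_idealI by blast
  next
    fix z assume "z \<in> residue_ideal b"
    then show "z \<in> P" unfolding residue_ideal_def using iff by blast
  qed
qed

text \<open>
A root \<open>b\<close> of \<open>h\<close> modulo \<open>p\<close> is matched with the unique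
prime of norm \<open>p\<close> above \<open>p\<close> that contains \<open>\<beta> - b\<close>.
\<close>
lemma card_degree_one_primes:
  "card {P \<in> primes_above p. card (coset P ` R) = p} = omega h p"
proof -
  let ?B = "{b \<in> {0..<int p}. [poly h b = 0] (mod int p)}"
  have "bij_betw residue_ideal ?B {P \<in> primes_above p. card (coset P ` R) = p}"
  proof (rule bij_betwI')
    fix b b' assume b: "b \<in> ?B" and b': "b' \<in> ?B"
    then have dvd: "int p dvd poly h b" "int p dvd poly h b'" by (auto simp: cong_0_iff)
    show "residue_ideal b = residue_ideal b' \<longleftrightarrow> b = b'"
    proof
      assume eq: "residue_ideal b = residue_ideal b'"
      let ?P = "residue_ideal b"
      have "(\<beta> - of_int b') - (\<beta> - of_int b) \<in> ?P"
        using ideal_diff[OF prime_residue_ideal[OF dvd(1)] _ beta_minus_in_residue_ideal[OF dvd(1)]]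
          beta_minus_in_residue_ideal[OF dvd(2)] by (simp only: eq)
      then have "of_int (b - b') \<in> ?P" by simp
      then have "int p dvd b - b'"
        using of_int_in_ideal_iff[OF prime_residue_ideal p p_in_residue_ideal, OF dvd(1) dvd(1)] by blast
      then show "b = b'" using b b'
        by (intro residue_eqI) auto
    qed simp
  next
    fix b assume "b \<in> ?B"
    then have "int p dvd poly h b" by (auto simp: cong_0_iff)
    then show "residue_ideal b \<in> {P \<in> primes_above p. card (coset P ` R) = p}"
      using prime_residue_ideal p_in_residue_ideal residue_ideal_norm by (simp add: primes_above_def)
  next
    fix P assume P: "P \<in> {P \<in> primes_above p. card (coset P ` R) = p}"
    then have "prime_ideal P" "of_nat p \<in> P" "card (coset P ` R) = p" by (auto simp: primes_above_def)
    then obtain b where b: "b \<in> {0..<int p}" "\<beta> - of_int b \<in> P"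
      using norm_eq_p_imp_residue[OF _ p _ _ beta_in_R] by blast
    then show "\<exists>b\<in>?B. P = residue_ideal b"
      using degree_one_prime_is_residue_ideal[of P b] P by (auto simp: cong_0_iff)
  qed
  then show ?thesis by (simp add: omega_def bij_betw_same_card)
qed

end

end

section \<open>Sums over primes and roots modulo a prime\<close>

lemma finite_primes_le: "finite {p :: nat. Factorial_Ring.prime p \<and> real p \<le> x}"
  by (rule finite_subset[of _ "{..nat \<lfloor>x\<rfloor>}"]) (auto simp: le_nat_floor)

text \<open>
Apart from \<open>2\<close>, which contributes \<open>1 / 4\<close>, primes have the form
\<open>2 k + 1\<close> with \<open>k \<ge> 1\<close>, and \<open>1 / (2 k + 1)\<^sup>2 \<le> (1
/ k - 1 / (k + 1)) / 4\<close> telescopes to another \<open>1 / 4\<close>.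
\<close>
lemma sum_inverse_squares_primes:
  fixes S :: "nat set"
  assumes S: "finite S" "\<And>p. p \<in> S \<Longrightarrow> Factorial_Ring.prime p"
  shows "(\<Sum>p\<in>S. 1 / (real p)\<^sup>2) \<le> 1 / 2"
proof -
  have odd: "(\<Sum>k=1..n. 1 / (real (2 * k + 1))\<^sup>2) \<le> 1 / 4 - 1 / (4 * (real n + 1))" for n
  proof (induction n)
    case (Suc n)
    have "4 * (real n + 1) * (real n + 2) \<le> (real (2 * Suc n + 1))\<^sup>2"
      by (simp add: power2_eq_square algebra_simps)
    then have "1 / (real (2 * Suc n + 1))\<^sup>2 \<le> 1 / (4 * (real n + 1) * (real n + 2))"
      by (intro frac_le mult_pos_pos) simp_all
    also have "\<dots> = 1 / (4 * (real n + 1)) - 1 / (4 * (real (Suc n) + 1))"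
      by (simp add: divide_simps)
    finally show ?case using Suc.IH by simp
  qed simp
  obtain n where n: "\<And>p. p \<in> S \<Longrightarrow> p \<le> n"
    using S(1) by (meson finite_nat_set_iff_bounded_le)
  have sub: "S \<subseteq> insert 2 ((\<lambda>k. 2 * k + 1) ` {1..n})"
  proof
    fix p assume p: "p \<in> S"
    show "p \<in> insert 2 ((\<lambda>k. 2 * k + 1) ` {1..n})"
    proof (cases "p = 2")
      case False
      then have "odd p" "p > 2" using S(2)[OF p] prime_odd_nat[of p] prime_ge_2_nat[of p] by auto
      then obtain k where "p = 2 * k + 1" by (auto elim: oddE)
      then show ?thesis using \<open>p > 2\<close> n[OF p] by auto
    qed simp
  qed
  have "(\<Sum>p\<in>S. 1 / (real p)\<^sup>2) \<le> (\<Sum>p\<in>insert 2 ((\<lambda>k. 2 * k + 1) ` {1..n}). 1 / (real p)\<^sup>2)"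
    by (intro sum_mono2 sub) auto
  also have "\<dots> = 1 / 4 + (\<Sum>p\<in>(\<lambda>k. 2 * k + 1) ` {1..n}. 1 / (real p)\<^sup>2)"
    by (subst sum.insert) auto
  also have "(\<Sum>p\<in>(\<lambda>k. 2 * k + 1) ` {1..n}. 1 / (real p)\<^sup>2) = (\<Sum>k=1..n. 1 / (real (2 * k + 1))\<^sup>2)"
    by (subst sum.reindex) (auto simp: inj_on_def)
  also have "1 / 4 + \<dots> \<le> 1 / 4 + 1 / 4"
    using odd[of n] by (smt (verit) divide_nonneg_nonneg of_nat_0_le_iff)
  finally show ?thesis by simp
qed

lemma poly_cong_mod:
  fixes q :: "int poly"
  assumes "n dvd a - b"
  shows "n dvd poly q a - poly q b"
proof (induction q)
  case (pCons c q)
  have "poly (pCons c q) a - poly (pCons c q) b = a * (poly q a - poly q b) + (a - b) * poly q b"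
    by (simp add: algebra_simps)
  then show ?case using pCons.IH assms by simp
qed simp

text \<open>
Lagrange's theorem on roots over the field with \<open>p\<close> elements, by splitting off one
root at a time.
\<close>
lemma card_roots_mod_prime:
  fixes q :: "int poly"
  assumes p: "Factorial_Ring.prime p" and q: "\<exists>i. \<not> p dvd Polynomial.coeff q i"
    and A: "finite A" "\<And>a. a \<in> A \<Longrightarrow> p dvd poly q a"
      "\<And>a b. a \<in> A \<Longrightarrow> b \<in> A \<Longrightarrow> p dvd a - b \<Longrightarrow> a = b"
  shows "card A \<le> Polynomial.degree q"
  using q A
proof (induction "Polynomial.degree q" arbitrary: q A)
  case 0
  then obtain c where c: "q = [:c:]" by (metis degree_eq_zeroE)
  obtain i where "\<not> p dvd Polynomial.coeff q i" using 0(2) by blast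
  then have "\<not> p dvd c" using c by (cases i) auto
  then have "A = {}" using 0(4) c by auto
  then show ?case by simp
next
  case (Suc n)
  show ?case
  proof (cases "A = {}")
    case False
    then obtain a where a: "a \<in> A" by blast
    define s where "s = synthetic_div q a"
    have qs: "q = [:-a, 1:] * s + [:poly q a:]"
      using synthetic_div_correct'[of a q] by (simp add: s_def)
    have deg: "n = Polynomial.degree s" using Suc.hyps(2) by (simp add: s_def degree_synthetic_div)
    have s: "\<exists>i. \<not> p dvd Polynomial.coeff s i"
    proof (rule ccontr)
      assume "\<nexists>i. \<not> p dvd Polynomial.coeff s i"
      then have "[:p:] dvd s" by (simp add: const_poly_dvd_iff)
      moreover have "[:p:] dvd [:poly q a:]" using Suc.prems(3)[OF a] by (simp add: const_poly_dvd)
      ultimately have "[:p:] dvd q" by (subst qs) (intro dvd_add dvd_mult)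
      then show False using Suc.prems(1) by (simp add: const_poly_dvd_iff)
    qed
    have "card (A - {a}) \<le> Polynomial.degree s"
    proof (rule Suc.hyps(1)[OF deg s])
      fix b assume b: "b \<in> A - {a}"
      have "poly q b = (b - a) * poly s b + poly q a"
        using arg_cong[OF qs, of "\<lambda>r. poly r b"] by (simp add: algebra_simps)
      then have "p dvd (b - a) * poly s b"
        using Suc.prems(3)[OF a] Suc.prems(3)[of b] b by (metis DiffD1 dvd_add_left_iff)
      moreover have "\<not> p dvd b - a" using Suc.prems(4)[of b a] a b by blast
      ultimately show "p dvd poly s b" using p by (simp add: prime_dvd_mult_iff)
    qed (use Suc.prems in auto)
    then show ?thesis using a Suc.prems(2) deg Suc.hyps(2) by (simp add: card_Diff_singleton)
  qed simp
qed

text \<open>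
An irreducible polynomial of positive degree is primitive, so it does not vanish identically
modulo \<open>p\<close>.
\<close>
lemma omega_le_degree:
  assumes irred: "Factorial_Ring.irreducible g" and deg: "Polynomial.degree g \<ge> 1"
    and p: "Factorial_Ring.prime (p :: nat)"
  shows "omega g p \<le> Polynomial.degree g"
  unfolding omega_def
proof (rule card_roots_mod_prime[of "int p"])
  show "\<exists>i. \<not> int p dvd Polynomial.coeff g i"
  proof (rule ccontr)
    assume "\<nexists>i. \<not> int p dvd Polynomial.coeff g i"
    then have "[:int p:] dvd g" by (simp add: const_poly_dvd_iff)
    then obtain q where q: "g = [:int p:] * q" by (metis dvdE)
    have "\<not> is_unit [:int p:]" using p by (auto simp: poly_dvd_1 is_unit_const_poly_iff)
    then have "is_unit q" using Factorial_Ring.irreducibleD[OF irred q] by blast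
    then show False using q deg p by (auto simp: poly_dvd_1 degree_mult_eq)
  qed
  show "finite {a \<in> {0..<int p}. [poly g a = 0] (mod int p)}"
    by (rule finite_subset[of _ "{0..<int p}"]) auto
qed (use p in \<open>auto simp: cong_0_iff intro: residue_eqI\<close>)

text \<open>
Multiplication by the leading coefficient of \<open>g\<close> permutes the residues modulo
\<open>p\<close> and takes the roots of \<open>g\<close> to those of the scaled polynomial.
\<close>
lemma omega_monic_scale:
  assumes deg: "Polynomial.degree g \<ge> 1" and p: "Factorial_Ring.prime (p :: nat)"
    and c: "\<not> int p dvd Polynomial.lead_coeff g"
  shows "omega (monic_scale g) p = omega g p"
proof -
  let ?c = "Polynomial.lead_coeff g" and ?h = "monic_scale g"
  have p0: "int p > 0" using p by (simp add: prime_gt_0_nat)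
  have "map_poly of_int q = q" for q :: "int poly" by (simp add: poly_eq_iff coeff_map_poly)
  then have h: "poly ?h (?c * a) = ?c ^ (Polynomial.degree g - 1) * poly g a" for a
    using poly_monic_scale[OF deg, where x = a] by simp
  have root_iff: "int p dvd poly ?h (?c * a) \<longleftrightarrow> int p dvd poly g a" for a
    using c p prime_dvd_power[of "int p" ?c] unfolding h by (auto simp: prime_dvd_mult_iff)
  have mod_iff: "int p dvd poly q (a mod int p) \<longleftrightarrow> int p dvd poly q a" for q a
    using poly_cong_mod[of "int p" "a mod int p" a q]
    by (metis dvd_diff_commute dvd_minus_mod dvd_add_right_iff diff_add_cancel)
  have "bij_betw (\<lambda>a. (?c * a) mod int p) {a \<in> {0..<int p}. [poly g a = 0] (mod int p)}
      {a \<in> {0..<int p}. [poly ?h a = 0] (mod int p)}"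
  proof (rule bij_betwI')
    fix a b assume ab: "a \<in> {a \<in> {0..<int p}. [poly g a = 0] (mod int p)}"
      "b \<in> {a \<in> {0..<int p}. [poly g a = 0] (mod int p)}"
    show "(?c * a) mod int p = (?c * b) mod int p \<longleftrightarrow> a = b"
    proof
      assume "(?c * a) mod int p = (?c * b) mod int p"
      then have "int p dvd ?c * (a - b)" by (simp add: mod_eq_dvd_iff algebra_simps)
      then have "int p dvd a - b" using c p by (simp add: prime_dvd_mult_iff)
      then show "a = b" using ab by (intro residue_eqI) auto
    qed simp
  next
    fix a assume "a \<in> {a \<in> {0..<int p}. [poly g a = 0] (mod int p)}"
    then show "(?c * a) mod int p \<in> {a \<in> {0..<int p}. [poly ?h a = 0] (mod int p)}"
      using p0 by (simp add: cong_0_iff mod_iff root_iff)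
  next
    fix b assume b: "b \<in> {a \<in> {0..<int p}. [poly ?h a = 0] (mod int p)}"
    obtain u t where ut: "u * ?c = 1 + int p * t" by (rule inverse_mod_prime[OF p c])
    have "(?c * ((u * b) mod int p)) mod int p = (?c * (u * b)) mod int p" by (rule mod_mult_right_eq)
    also have "?c * (u * b) = b + int p * (t * b)"
      using arg_cong[OF ut, of "\<lambda>t. t * b"] by (simp add: algebra_simps)
    also have "\<dots> mod int p = b mod int p" by (rule mod_mult_self2)
    also have "\<dots> = b" using b by simp
    finally have eq: "b = (?c * ((u * b) mod int p)) mod int p" by simp
    have "int p dvd poly ?h b" using b by (simp add: cong_0_iff)
    then have "int p dvd poly g ((u * b) mod int p)"
      by (subst (asm) eq) (simp only: mod_iff[of ?h] root_iff)
    then have "(u * b) mod int p \<in> {a \<in> {0..<int p}. [poly g a = 0] (mod int p)}"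
      using p0 by (simp add: cong_0_iff)
    with eq show "\<exists>a\<in>{a \<in> {0..<int p}. [poly g a = 0] (mod int p)}. b = (?c * a) mod int p"
      by blast
  qed
  then show ?thesis unfolding omega_def by (simp add: bij_betw_same_card)
qed

text \<open>
The substitutions \<open>X \<mapsto> c X\<close> and \<open>X \<mapsto> X / c\<close> carry
divisibility by \<open>g\<close>, known from \<open>irreducible_dvd_if_common_root\<close>, to
divisibility by the scaled polynomial.
\<close>
lemma monic_generator_monic_scale:
  fixes \<alpha> :: complex
  assumes irred: "Factorial_Ring.irreducible g" and deg: "Polynomial.degree g \<ge> 1"
    and root: "poly (map_poly of_int g) \<alpha> = 0"
  shows "monic_generator (monic_scale g) (of_int (Polynomial.lead_coeff g) * \<alpha>)"
proof
  let ?c = "Polynomial.lead_coeff g"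
  have c0: "?c \<noteq> 0" using deg by auto
  show "Polynomial.lead_coeff (monic_scale g) = 1" by (rule monic_monic_scale)
  show "Polynomial.degree (monic_scale g) \<ge> 1" using deg by (simp add: degree_monic_scale)
  show "poly (map_poly of_int (monic_scale g)) (of_int ?c * \<alpha>) = 0"
    by (simp add: poly_monic_scale[OF deg] root)
  fix q assume q: "poly (cpoly q) (of_int ?c * \<alpha>) = 0"
  let ?c' = "of_int ?c :: rat"
  let ?G = "map_poly of_int g :: rat poly"
  have "poly (cpoly (pcompose q [:0, ?c':])) \<alpha> = 0"
    using q by (simp add: poly_cpoly_pcompose map_pCons_simps mult.commute)
  from irreducible_dvd_if_common_root[OF irred deg root this]
  obtain s where s: "pcompose q [:0, ?c':] = ?G * s" by (metis dvdE)
  have scale: "x * inverse ?c' * ?c' = x" "?c' * (x * inverse ?c') = x" for x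
    using c0 by simp_all
  have "poly q x = poly (pcompose ?G [:0, inverse ?c':] * pcompose s [:0, inverse ?c':]) x" for x
    using arg_cong[OF s, of "\<lambda>r. poly r (x * inverse ?c')"] scale(1)[of x]
    by (simp add: poly_pcompose)
  then have "q = pcompose ?G [:0, inverse ?c':] * pcompose s [:0, inverse ?c':]"
    using poly_eq_poly_eq_iff by blast
  then have "pcompose ?G [:0, inverse ?c':] dvd q" by simp
  moreover have "map_poly of_int (monic_scale g) =
      Polynomial.smult (?c' ^ (Polynomial.degree g - 1)) (pcompose ?G [:0, inverse ?c':])"
  proof -
    have "poly (map_poly of_int (monic_scale g)) x =
      poly (Polynomial.smult (?c' ^ (Polynomial.degree g - 1)) (pcompose ?G [:0, inverse ?c':])) x" for x
      using poly_monic_scale[OF deg, of "x * inverse ?c'"] scale(2)[of x] by (simp add: poly_pcompose)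
    then show ?thesis using poly_eq_poly_eq_iff by blast
  qed
  ultimately show "map_poly of_int (monic_scale g) dvd q"
    using c0 by (simp add: smult_dvd_iff)
qed

context monic_generator
begin

section \<open>Comparison of the two sums\<close>

text \<open>
The prime ideals of norm \<open>p\<close> are removed exactly; each of the at most
\<open>d\<close> others has norm at least \<open>p\<^sup>2\<close>.
\<close>
lemma sum_over_primes_above:
  assumes p: "Factorial_Ring.prime p" "real p \<le> x"
  defines "T \<equiv> {P \<in> primes_above p. real (ideal_norm (ring_of_integers K) P) \<le> x}"
    and "n1 \<equiv> card {P \<in> primes_above p. card (coset P ` R) = p}"
  shows "\<bar>(\<Sum>P\<in>T. 1 / real (ideal_norm (ring_of_integers K) P)) - real n1 / real p\<bar> \<le> real d * (1 / (real p)\<^sup>2)"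
proof -
  let ?N = "ideal_norm (ring_of_integers K)"
  let ?T1 = "{P \<in> primes_above p. card (coset P ` R) = p}"
  have fin: "finite (primes_above p)" "card (primes_above p) \<le> d"
    using card_primes_above[OF p(1)] by auto
  then have finT: "finite T" by (simp add: T_def)
  have p0: "p > 0" using p(1) by (simp add: prime_gt_0_nat)
  have "?T1 \<subseteq> T" using p(2) by (auto simp: T_def ideal_norm_eq)
  then have "(\<Sum>P\<in>T. 1 / real (?N P)) = (\<Sum>P\<in>T - ?T1. 1 / real (?N P)) + (\<Sum>P\<in>?T1. 1 / real (?N P))"
    by (intro sum.subset_diff finT)
  also have "(\<Sum>P\<in>?T1. 1 / real (?N P)) = (\<Sum>P\<in>?T1. 1 / real p)"
    by (intro sum.cong) (auto simp: ideal_norm_eq)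
  also have "\<dots> = real n1 / real p" by (simp add: n1_def)
  finally have eq: "(\<Sum>P\<in>T. 1 / real (?N P)) - real n1 / real p = (\<Sum>P\<in>T - ?T1. 1 / real (?N P))"
    by simp
  have "(\<Sum>P\<in>T - ?T1. 1 / real (?N P)) \<le> (\<Sum>P\<in>T - ?T1. 1 / (real p)\<^sup>2)"
  proof (rule sum_mono)
    fix P assume "P \<in> T - ?T1"
    then have "prime_ideal P" "of_nat p \<in> P" "?N P \<noteq> p" by (auto simp: T_def primes_above_def ideal_norm_eq)
    then have "?N P \<ge> p\<^sup>2" using norm_p_or_ge_p2[OF _ p(1)] by (auto simp: ideal_norm_eq)
    then have "real (?N P) \<ge> (real p)\<^sup>2" by (simp flip: of_nat_power)
    then show "1 / real (?N P) \<le> 1 / (real p)\<^sup>2" using p0 by (intro frac_le) simp_all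
  qed
  also have "\<dots> = real (card (T - ?T1)) * (1 / (real p)\<^sup>2)" by simp
  also have "\<dots> \<le> real d * (1 / (real p)\<^sup>2)"
  proof (rule mult_right_mono)
    have "card (T - ?T1) \<le> card (primes_above p)"
      by (intro card_mono fin) (auto simp: T_def)
    then show "real (card (T - ?T1)) \<le> real d" using fin(2) by simp
  qed simp
  finally have "(\<Sum>P\<in>T - ?T1. 1 / real (?N P)) \<le> real d * (1 / (real p)\<^sup>2)" .
  moreover have "(\<Sum>P\<in>T - ?T1. 1 / real (?N P)) \<ge> 0" by (intro sum_nonneg) auto
  ultimately show ?thesis unfolding eq by simp
qed

text \<open>
Groups the prime ideals by the rational prime that they contain, which is at most the norm.
\<close>
lemma sum_over_prime_ideals:
  "(\<Sum>P | primeideal P (ring_of_integers K) \<and> P \<noteq> {0} \<and> real (ideal_norm (ring_of_integers K) P) \<le> x.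
      1 / real (ideal_norm (ring_of_integers K) P)) =
   (\<Sum>p | Factorial_Ring.prime p \<and> real p \<le> x.
      \<Sum>P | P \<in> primes_above p \<and> real (ideal_norm (ring_of_integers K) P) \<le> x.
        1 / real (ideal_norm (ring_of_integers K) P))"
proof -
  let ?N = "ideal_norm (ring_of_integers K)"
  let ?T = "\<lambda>p. {P \<in> primes_above p. real (?N P) \<le> x}"
  let ?S = "{p. Factorial_Ring.prime p \<and> real p \<le> x}"
  have union: "{P. primeideal P (ring_of_integers K) \<and> P \<noteq> {0} \<and> real (?N P) \<le> x} = (\<Union>p\<in>?S. ?T p)"
  proof (rule equalityI; rule subsetI)
    fix P assume P: "P \<in> {P. primeideal P (ring_of_integers K) \<and> P \<noteq> {0} \<and> real (?N P) \<le> x}"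
    then have PP: "prime_ideal P" by (simp add: primeideal_iff)
    obtain p where p: "Factorial_Ring.prime p" "of_nat p \<in> P"
      using ideal_contains_prime[OF PP] P by blast
    have "p \<le> p\<^sup>2" by (simp add: power2_eq_square)
    then have "p \<le> ?N P" using norm_p_or_ge_p2[OF PP p] by (auto simp: ideal_norm_eq)
    then have "real p \<le> x" using P by auto
    then show "P \<in> (\<Union>p\<in>?S. ?T p)" using p PP P by (auto simp: primes_above_def)
  next
    fix P assume "P \<in> (\<Union>p\<in>?S. ?T p)"
    then obtain p where p: "Factorial_Ring.prime p" "prime_ideal P" "of_nat p \<in> P" "real (?N P) \<le> x"
      by (auto simp: primes_above_def)
    then have "P \<noteq> {0}" using prime_gt_0_nat[OF p(1)] by auto
    then show "P \<in> {P. primeideal P (ring_of_integers K) \<and> P \<noteq> {0} \<and> real (?N P) \<le> x}"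
      using p by (simp add: primeideal_iff)
  qed
  have disj: "?T p \<inter> ?T q = {}" if "p \<in> ?S" "q \<in> ?S" "p \<noteq> q" for p q
  proof (rule ccontr)
    assume "?T p \<inter> ?T q \<noteq> {}"
    then obtain P where P: "prime_ideal P" "of_nat p \<in> P" "of_nat q \<in> P" by (auto simp: primes_above_def)
    have "of_int (int q) \<in> P" using P by simp
    then have "int p dvd int q" using of_int_in_ideal_iff[OF P(1) _ P(2)] that by blast
    then show False using that by (simp add: primes_dvd_imp_eq)
  qed
  have "\<forall>p\<in>?S. finite (?T p)" using card_primes_above by simp
  then show ?thesis unfolding union
    by (rule sum.UNION_disjoint[OF finite_primes_le]) (intro ballI impI disj)
qed

end

theorem theorem1:
  fixes g :: "int poly" and d :: nat and c :: int and \<alpha> :: complex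
    and K :: "complex set" and D x :: real
  assumes irred: "Factorial_Ring.irreducible g"
    and d: "d = Polynomial.degree g" "d \<ge> 1"
    and c: "c = Polynomial.lead_coeff g"
    and root: "poly (map_poly of_int g) \<alpha> = 0"
    and K: "K = rat_adjoin \<alpha>"
    and D: "D = real_of_int \<bar>c\<bar> ^ ((d - 1) * (d - 2)) * cmod (discriminant (map_poly of_int g))"
    and x: "x > max 2 (sqrt D)"
  shows "\<exists>A :: real.
    (\<Sum>p | Factorial_Ring.prime p \<and> real p \<le> x. real (omega g p) / real p) =
      (\<Sum>P | primeideal P (ring_of_integers K) \<and> P \<noteq> {0} \<and>
             real (ideal_norm (ring_of_integers K) P) \<le> x.
         1 / real (ideal_norm (ring_of_integers K) P)) + A \<and>
    \<bar>A\<bar> \<le> real d * (recip_prime_sum (real_of_int \<bar>c\<bar>) + recip_prime_sum (sqrt D) + 0.64)"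
proof -
  have deg: "Polynomial.degree g \<ge> 1" using d by simp
  interpret M: monic_generator "monic_scale g" "of_int c * \<alpha>"
    unfolding c by (rule monic_generator_monic_scale[OF irred deg root])
  have c0: "c \<noteq> 0" using deg c by auto
  have KM: "K = M.K" unfolding K by (rule M.rat_adjoin_eq_K[OF c0 refl])
  have Md: "Polynomial.degree (monic_scale g) = d" by (simp add: degree_monic_scale d)
  obtain rs where rs: "mset rs = proots (map_poly of_int (monic_scale g) :: complex poly)"
    using ex_mset by blast
  have disc: "cmod (sq_diff_prod rs) = D"
    by (simp add: sq_diff_prod_monic_scale[OF deg rs] D d c norm_mult norm_power)
  let ?S = "{p. Factorial_Ring.prime p \<and> real p \<le> x}"
  let ?N = "ideal_norm (ring_of_integers K)"
  let ?T = "\<lambda>p. {P. P \<in> M.primes_above p \<and> real (?N P) \<le> x}"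
  let ?E = "\<lambda>p. \<Sum>P\<in>?T p. 1 / real (?N P)"
  \<comment> \<open>\<open>?E p\<close> is the contribution of the prime ideals above \<open>p\<close>, and \<open>?B p\<close> vanishes for the primes at
    which roots of \<open>g\<close> and prime ideals of norm \<open>p\<close> correspond.\<close>
  let ?B = "\<lambda>p. if real p \<le> real_of_int \<bar>c\<bar> \<or> real p \<le> sqrt D then 1 / real p else 0"
  define A where "A = (\<Sum>p\<in>?S. real (omega g p) / real p - ?E p)"
  have local: "\<bar>real (omega g p) / real p - ?E p\<bar> \<le> real d * ?B p + real d * (1 / (real p)\<^sup>2)"
    if pS: "p \<in> ?S" for p
  proof -
    define n1 where "n1 = card {P \<in> M.primes_above p. card (M.coset P ` M.R) = p}"
    have p: "Factorial_Ring.prime p" "real p \<le> x" using pS by auto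
    have E: "\<bar>?E p - real n1 / real p\<bar> \<le> real d * (1 / (real p)\<^sup>2)"
      using M.sum_over_primes_above[OF p] by (simp add: Md KM n1_def)
    have "\<bar>real (omega g p) / real p - real n1 / real p\<bar> \<le> real d * ?B p"
    proof (cases "real p \<le> real_of_int \<bar>c\<bar> \<or> real p \<le> sqrt D")
      case True
      have "omega g p \<le> d" unfolding d by (rule omega_le_degree[OF irred deg p(1)])
      moreover have "n1 \<le> card (M.primes_above p)"
        unfolding n1_def using M.card_primes_above[OF p(1)] by (intro card_mono) auto
      then have "n1 \<le> d" using M.card_primes_above[OF p(1)] Md by simp
      ultimately have "\<bar>real (omega g p) - real n1\<bar> \<le> real d" by linarith
      then have "\<bar>real (omega g p) - real n1\<bar> / real p \<le> real d / real p"
        by (intro divide_right_mono) auto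
      then show ?thesis using True by (simp add: abs_divide flip: diff_divide_distrib)
    next
      case False
      have "\<not> int p dvd c"
      proof
        assume "int p dvd c"
        then have "int p \<le> \<bar>c\<bar>" using dvd_imp_le_int[OF c0] by fastforce
        then have "real p \<le> real_of_int \<bar>c\<bar>" by linarith
        then show False using False by blast
      qed
      then have om: "omega (monic_scale g) p = omega g p"
        unfolding c by (rule omega_monic_scale[OF deg p(1)])
      have "D < (real p)\<^sup>2" using False real_le_rsqrt[of "real p" D] by force
      then have disc_p: "cmod (sq_diff_prod rs) < (real p)\<^sup>2" by (simp add: disc)
      have "n1 = omega (monic_scale g) p" unfolding n1_def
      proof (rule M.card_degree_one_primes[OF p(1)])
        fix z assume "z \<in> M.R"
        then show "\<exists>m q. \<not> p dvd m \<and> of_nat m * z = M.ev q"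
          using M.coprime_denominator[OF p(1) rs disc_p] by blast
      qed
      then show ?thesis using om False by simp
    qed
    then show ?thesis using E by linarith
  qed
  have sums: "(\<Sum>p\<in>?S. real (omega g p) / real p) =
      (\<Sum>P | primeideal P (ring_of_integers K) \<and> P \<noteq> {0} \<and> real (?N P) \<le> x. 1 / real (?N P)) + A"
    unfolding KM M.sum_over_prime_ideals A_def by (simp add: sum_subtractf)
  have "\<bar>A\<bar> \<le> (\<Sum>p\<in>?S. real d * ?B p + real d * (1 / (real p)\<^sup>2))"
    unfolding A_def by (rule order.trans[OF sum_abs sum_mono[OF local]])
  also have "\<dots> = real d * ((\<Sum>p\<in>?S. ?B p) + (\<Sum>p\<in>?S. 1 / (real p)\<^sup>2))"
    by (simp only: sum.distrib sum_distrib_left distrib_left)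
  also have "\<dots> \<le> real d * (recip_prime_sum (real_of_int \<bar>c\<bar>) + recip_prime_sum (sqrt D) + 0.64)"
  proof (rule mult_left_mono)
    let ?P = "\<lambda>y. {p. Factorial_Ring.prime p \<and> real p \<le> y}"
    have "(\<Sum>p\<in>?S. ?B p) = (\<Sum>p\<in>{p \<in> ?S. real p \<le> real_of_int \<bar>c\<bar> \<or> real p \<le> sqrt D}. 1 / real p)"
      by (rule sum.inter_filter[symmetric, OF finite_primes_le])
    also have "\<dots> \<le> (\<Sum>p\<in>?P (real_of_int \<bar>c\<bar>) \<union> ?P (sqrt D). 1 / real p)"
      by (intro sum_mono2 finite_UnI finite_primes_le) auto
    also have "\<dots> \<le> recip_prime_sum (real_of_int \<bar>c\<bar>) + recip_prime_sum (sqrt D)"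
    proof -
      have "(\<Sum>p\<in>?P (real_of_int \<bar>c\<bar>) \<inter> ?P (sqrt D). 1 / real p) \<ge> 0" by (intro sum_nonneg) simp
      then show ?thesis unfolding recip_prime_sum_def
        using sum.union_inter[OF finite_primes_le[of "real_of_int \<bar>c\<bar>"] finite_primes_le[of "sqrt D"],
            of "\<lambda>p. 1 / real p"] by linarith
    qed
    finally have "(\<Sum>p\<in>?S. ?B p) \<le> recip_prime_sum (real_of_int \<bar>c\<bar>) + recip_prime_sum (sqrt D)" .
    moreover have "(\<Sum>p\<in>?S. 1 / (real p)\<^sup>2) \<le> 1 / 2"
      by (intro sum_inverse_squares_primes finite_primes_le) auto
    ultimately show "(\<Sum>p\<in>?S. ?B p) + (\<Sum>p\<in>?S. 1 / (real p)\<^sup>2) \<le>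
        recip_prime_sum (real_of_int \<bar>c\<bar>) + recip_prime_sum (sqrt D) + 0.64" by simp
  qed simp
  finally show ?thesis using sums by blast
qed

end
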